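(* Let $n\ge2$, let $U\subset\mathbb{R}^n$ be open, $X\in C^2(U,\mathbb{R}^n)$, $p\in U$ with $X(p)=0$, $J:=DX(p)$, and assume $\operatorname{rank}J=n-1$, $e_{n-1}(J)=0$, $e_{n-2}(J)\neq0$. Let $q_0$ span $\ker J$ and let $(a,b)$ be the Bogdanov--Takens coefficients associated with $(X,p,q_0)$. On the open set $U'\subset U$ where $e_{n-2}(DX(x))\neq0$ let $$\delta:=\frac{e_n(DX)}{e_{n-2}(DX)},\qquad \tau:=\frac{e_{n-1}(DX)-\delta\,e_{n-3}(DX)}{e_{n-2}(DX)},$$ and put $S_\delta:=\{x\in U':\delta(x)=0\}=\{x\in U':\det DX(x)=0\}$, $S_\tau:=\{x\in U':\tau(x)=0\}$, $\ell:=p+\mathbb{R}q_0$. Then $$a\neq0\iff \ell\pitchfork_p S_\delta,\qquad b\neq0\iff \ell\pitchfork_p S_\tau,$$ and in either case the corresponding set is a $C^1$ hypersurface near $p$.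
   Context: For a real $m\times m$ matrix $A$, $e_k(A)$ is the sum of the principal $k\times k$ minors of $A$, so that $\det(\lambda I-A)=\sum_{k=0}^m(-1)^k e_k(A)\lambda^{m-k}$; $e_0=1$, $e_k:=0$ for $k<0$. Transversality $\ell\pitchfork_p\{f=0\}$ of the line $\ell=p+\mathbb{R}q_0$ to the zero set of a $C^1$ function $f$ with $f(p)=0$ means: $df_p\neq0$ and $q_0\notin\ker df_p$. Under the stated conditions on $J$, $\mathbb{R}^n=E^c\oplus E^{\mathrm{tr}}$ with $E^c:=\ker J^2$, $E^{\mathrm{tr}}:=\operatorname{im}J^2$, both $J$-invariant, $\dim E^c=2$, $J|_{E^c}$ nilpotent of rank one. Definition of $(a,b)$: choose $q_1\in E^c$ with $Jq_1=q_0$; let $p_0,p_1$ be the covectors determined by $\langle p_0,q_0\rangle=\langle p_1,q_1\rangle=1$, $\langle p_0,q_1\rangle=\langle p_1,q_0\rangle=0$, $p_0|_{E^{\mathrm{tr}}}=p_1|_{E^{\mathrm{tr}}}=0$. With $B(u,v):=D^2X(p)[u,v]$, $a:=\tfrac12\langle p_1,B(q_0,q_0)\rangle$ and $b:=\langle p_0,B(q_0,q_0)\rangle+\langle p_1,B(q_0,q_1)\rangle$; the pair does not depend on the choice of $q_1$. *)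

theory Defs
  imports "HOL-Analysis.Analysis"
begin

definition C1_on :: "'a::real_normed_vector set \<Rightarrow> ('a \<Rightarrow> 'b::real_normed_vector) \<Rightarrow> bool" where
  "C1_on U f \<longleftrightarrow>
     (\<exists>f' :: 'a \<Rightarrow> 'a \<Rightarrow>\<^sub>L 'b.
        (\<forall>x\<in>U. (f has_derivative blinfun_apply (f' x)) (at x)) \<and> continuous_on U f')"

definition C2_on :: "'a::real_normed_vector set \<Rightarrow> ('a \<Rightarrow> 'b::real_normed_vector) \<Rightarrow> bool" where
  "C2_on U f \<longleftrightarrow>
     (\<exists>f' :: 'a \<Rightarrow> 'a \<Rightarrow>\<^sub>L 'b.
        (\<forall>x\<in>U. (f has_derivative blinfun_apply (f' x)) (at x)) \<and> C1_on U f')"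

text \<open>The determinant of the principal submatrix with row and column set \<open>S\<close>: the Leibniz
  formula defining \<^const>\<open>det\<close>, with \<open>S\<close> in place of the whole index type.\<close>

definition principal_minor :: "real^'n^'n \<Rightarrow> 'n set \<Rightarrow> real" where
  "principal_minor A S = (\<Sum>\<pi> | \<pi> permutes S. of_int (sign \<pi>) * (\<Prod>i\<in>S. A $ i $ \<pi> i))"

text \<open>The index is an integer, so that \<open>e_coeff k A = 0\<close> for \<open>k < 0\<close> (the sum is then empty).\<close>

definition e_coeff :: "int \<Rightarrow> real^'n^'n \<Rightarrow> real" where
  "e_coeff k A = (\<Sum>S | int (card S) = k. principal_minor A S)"

abbreviation DX :: "(real^'n \<Rightarrow> real^'n) \<Rightarrow> real^'n \<Rightarrow> real^'n^'n" where
  "DX X x \<equiv> jacobian X (at x)"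

text \<open>\<open>D\<^sup>2X(p)[u,v]\<close>: differentiate the Jacobian matrix in direction \<open>u\<close>, then apply it to \<open>v\<close>.\<close>

definition D2X :: "(real^'n \<Rightarrow> real^'n) \<Rightarrow> real^'n \<Rightarrow> real^'n \<Rightarrow> real^'n \<Rightarrow> real^'n" where
  "D2X X p u v = frechet_derivative (\<lambda>x. DX X x) (at p) u *v v"

definition center_space :: "real^'n^'n \<Rightarrow> (real^'n) set" where
  "center_space J = {v. (J ** J) *v v = 0}"

definition transverse_space :: "real^'n^'n \<Rightarrow> (real^'n) set" where
  "transverse_space J = range (\<lambda>v. (J ** J) *v v)"

text \<open>Covectors are represented by vectors acting through the standard inner product.\<close>

definition bt_frame ::
  "real^'n^'n \<Rightarrow> real^'n \<Rightarrow> real^'n \<Rightarrow> real^'n \<Rightarrow> real^'n \<Rightarrow> bool" where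
  "bt_frame J q0 q1 p0 p1 \<longleftrightarrow>
     q1 \<in> center_space J \<and> J *v q1 = q0 \<and>
     p0 \<bullet> q0 = 1 \<and> p1 \<bullet> q1 = 1 \<and> p0 \<bullet> q1 = 0 \<and> p1 \<bullet> q0 = 0 \<and>
     (\<forall>v\<in>transverse_space J. p0 \<bullet> v = 0 \<and> p1 \<bullet> v = 0)"

text \<open>The coefficient pair \<open>(a, b)\<close>. It is the same for every choice of \<open>q1\<close>, which also
  determines \<open>p0\<close> and \<open>p1\<close>; hence the definite description.\<close>

definition bt_coefficients ::
  "(real^'n \<Rightarrow> real^'n) \<Rightarrow> real^'n \<Rightarrow> real^'n \<Rightarrow> real \<times> real" where
  "bt_coefficients X p q0 =
     (THE ab. \<exists>q1 p0 p1. bt_frame (DX X p) q0 q1 p0 p1 \<and>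
        ab = (1/2 * (p1 \<bullet> D2X X p q0 q0),
              p0 \<bullet> D2X X p q0 q0 + p1 \<bullet> D2X X p q0 q1))"

definition regular_domain :: "(real^'n \<Rightarrow> real^'n) \<Rightarrow> (real^'n) set \<Rightarrow> (real^'n) set" where
  "regular_domain X U = {x\<in>U. e_coeff (int CARD('n) - 2) (DX X x) \<noteq> 0}"

definition bt_delta :: "(real^'n \<Rightarrow> real^'n) \<Rightarrow> real^'n \<Rightarrow> real" where
  "bt_delta X x = e_coeff (int CARD('n)) (DX X x) / e_coeff (int CARD('n) - 2) (DX X x)"

definition bt_tau :: "(real^'n \<Rightarrow> real^'n) \<Rightarrow> real^'n \<Rightarrow> real" where
  "bt_tau X x =
     (e_coeff (int CARD('n) - 1) (DX X x) - bt_delta X x * e_coeff (int CARD('n) - 3) (DX X x))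
       / e_coeff (int CARD('n) - 2) (DX X x)"

text \<open>Transversality at \<open>p\<close> of the line \<open>p + \<real> q\<close> to the zero set of the \<open>C\<^sup>1\<close> function
  \<open>f\<close> on the open set \<open>D\<close>. The standing requirements on \<open>f\<close> are part of the predicate,
  so \<^const>\<open>frechet_derivative\<close> denotes the actual derivative.\<close>

definition line_transversal ::
  "'a::real_normed_vector set \<Rightarrow> ('a \<Rightarrow> real) \<Rightarrow> 'a \<Rightarrow> 'a \<Rightarrow> bool" where
  "line_transversal D f p q \<longleftrightarrow>
     open D \<and> p \<in> D \<and> C1_on D f \<and> f p = 0 \<and>
     frechet_derivative f (at p) \<noteq> (\<lambda>v. 0) \<and>
     q \<notin> {v. frechet_derivative f (at p) v = 0}"

text \<open>Near \<open>p \<in> S\<close>, a \<open>C\<^sup>1\<close> diffeomorphism takes \<open>S\<close> to a piece of a linear hyperplane.\<close>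

definition C1_hypersurface_near :: "'a::euclidean_space set \<Rightarrow> 'a \<Rightarrow> bool" where
  "C1_hypersurface_near S p \<longleftrightarrow>
     p \<in> S \<and>
     (\<exists>W V \<phi> \<psi> c. open W \<and> open V \<and> p \<in> W \<and>
        homeomorphism W V \<phi> \<psi> \<and> C1_on W \<phi> \<and> C1_on V \<psi> \<and>
        (c::'a) \<noteq> 0 \<and> \<phi> ` (S \<inter> W) = {y\<in>V. c \<bullet> y = 0})"

end

theory Submission
  imports Defs
begin

text \<open>
  Put \<open>J = DX(p)\<close> and \<open>A = D(DX)(p)[q0]\<close>, and let \<open>P\<close> be the projection onto \<open>ker J\<^sup>2\<close> along
  \<open>im J\<^sup>2\<close>. The derivative of \<open>det (\<lambda>I + DX)\<close> at \<open>p\<close> along \<open>q0\<close> is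
  \<open>det (\<lambda>I + J) tr ((\<lambda>I + J)\<^sup>-\<^sup>1 A)\<close>, where \<open>det (\<lambda>I + J) = \<lambda>\<^sup>2 (e\<^sub>n\<^sub>-\<^sub>2 + e\<^sub>n\<^sub>-\<^sub>3 \<lambda> + O(\<lambda>\<^sup>2))\<close> and
  \<open>(\<lambda>I + J)\<^sup>-\<^sup>1 = P / \<lambda> - JP / \<lambda>\<^sup>2 + O(1)\<close>, with \<open>tr (JPA) = 2a\<close> and \<open>tr (PA) = b\<close>. Comparing the
  coefficients of \<open>1\<close> and \<open>\<lambda>\<close> gives the derivatives of \<open>e\<^sub>n\<close> and \<open>e\<^sub>n\<^sub>-\<^sub>1\<close>, hence
  \<open>D\<delta>(p) q0 = - 2a\<close> and \<open>D\<tau>(p) q0 = b\<close>. The hypersurface statement is then the inverse function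
  theorem.
\<close>

subsection \<open>Expansion and differentiation of determinants\<close>

text \<open>Multiply out each Leibniz product: \<open>S\<close> collects the indices that contribute
  an entry of \<open>A\<close>. The other factors come from \<open>mat l\<close> and survive only if
  \<pi> fixes every index outside \<open>S\<close>, that is, if \<pi> permutes
  \<open>S\<close>.\<close>

lemma det_mat_add_subsets:
  fixes A :: "real^'n^'n"
  shows "det (mat l + A) = (\<Sum>S\<in>UNIV. principal_minor A S * l ^ card (- S))"
proof -
  have prod: "(\<Prod>i\<in>UNIV. (mat l + A) $ i $ \<pi> i) =
      (\<Sum>S\<in>UNIV. if \<pi> permutes S then (\<Prod>i\<in>S. A $ i $ \<pi> i) * l ^ card (- S) else 0)"
    if \<pi>: "\<pi> permutes UNIV" for \<pi> :: "'n \<Rightarrow> 'n"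
  proof -
    have "(\<Prod>i\<in>- S. mat l $ i $ \<pi> i) = (if \<pi> permutes S then l ^ card (- S) else 0)" for S
    proof (cases "\<pi> permutes S")
      case True
      then have "(\<Prod>i\<in>- S. mat l $ i $ \<pi> i) = (\<Prod>i\<in>- S. l)"
        by (intro prod.cong) (auto simp: mat_def permutes_not_in)
      with True show ?thesis by simp
    next
      case False
      \<comment> \<open>An index outside \<open>S\<close> that \<pi> moves picks an off-diagonal
        zero of \<open>mat l\<close>.\<close>
      then obtain i where "i \<notin> S" "\<pi> i \<noteq> i"
        using permutes_superset[OF \<pi>, of S] by auto
      with False show ?thesis
        by (auto simp: mat_def intro!: bexI[of _ i])
    qed
    then have "(\<Prod>i\<in>S. A $ i $ \<pi> i) * (\<Prod>i\<in>- S. mat l $ i $ \<pi> i) =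
        (if \<pi> permutes S then (\<Prod>i\<in>S. A $ i $ \<pi> i) * l ^ card (- S) else 0)" for S
      by simp
    then show ?thesis
      using prod_add[of UNIV "\<lambda>i. A $ i $ \<pi> i" "\<lambda>i. mat l $ i $ \<pi> i"]
      by (simp add: add.commute Compl_eq_Diff_UNIV)
  qed
  have "det (mat l + A) = (\<Sum>\<pi> | \<pi> permutes UNIV. \<Sum>S\<in>UNIV. if \<pi> permutes S
      then of_int (sign \<pi>) * (\<Prod>i\<in>S. A $ i $ \<pi> i) * l ^ card (- S) else 0)"
    unfolding det_def
  proof (intro sum.cong refl)
    fix \<pi> :: "'n \<Rightarrow> 'n"
    assume "\<pi> \<in> {\<pi>. \<pi> permutes UNIV}"
    then have "\<pi> permutes UNIV" by simp
    from prod[OF this] show "of_int (sign \<pi>) * (\<Prod>i\<in>UNIV. (mat l + A) $ i $ \<pi> i) =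
      (\<Sum>S\<in>UNIV. if \<pi> permutes S
        then of_int (sign \<pi>) * (\<Prod>i\<in>S. A $ i $ \<pi> i) * l ^ card (- S) else 0)"
      by (auto simp only: sum_distrib_left mult.assoc if_distrib[of "\<lambda>x. _ * x"] mult_zero_right
        intro!: sum.cong)
  qed
  also have "\<dots> = (\<Sum>S\<in>UNIV. \<Sum>\<pi> | \<pi> permutes UNIV. if \<pi> permutes S
      then of_int (sign \<pi>) * (\<Prod>i\<in>S. A $ i $ \<pi> i) * l ^ card (- S) else 0)"
    by (rule sum.swap)
  also have "\<dots> = (\<Sum>S\<in>UNIV. principal_minor A S * l ^ card (- S))"
  proof (rule sum.cong[OF refl])
    fix S :: "'n set"
    have "{\<pi>. \<pi> permutes UNIV \<and> \<pi> permutes S} = {\<pi>. \<pi> permutes S}"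
      by (auto intro: permutes_subset)
    then show "(\<Sum>\<pi> | \<pi> permutes UNIV. if \<pi> permutes S
      then of_int (sign \<pi>) * (\<Prod>i\<in>S. A $ i $ \<pi> i) * l ^ card (- S) else 0) =
      principal_minor A S * l ^ card (- S)"
      by (simp add: principal_minor_def sum_distrib_right flip: sum.inter_filter)
  qed
  finally show ?thesis .
qed

text \<open>Subsets are grouped by the size of their complement. The bound \<open>N\<close> may
  exceed the dimension because \<open>e_coeff\<close> vanishes at negative indices; this slack lets
  low-order terms be split off without case distinctions on \<open>CARD('n)\<close>.\<close>

lemma det_mat_add:
  fixes A :: "real^'n^'n"
  assumes "CARD('n) \<le> N"
  shows "det (mat l + A) = (\<Sum>j\<le>N. e_coeff (int CARD('n) - int j) A * l ^ j)"
proof -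
  have "int (card S) = int CARD('n) - int (card (- S))" for S :: "'n set"
    using card_Un_disjoint[of S "- S"] by (simp add: Compl_partition)
  then have "int (card S) = int CARD('n) - int j \<longleftrightarrow> card (- S) = j" for S :: "'n set" and j
    by (metis diff_eq_eq diff_left_imp_eq of_nat_eq_iff diff_diff_eq2 add_diff_cancel_left')
  then have "e_coeff (int CARD('n) - int j) A * l ^ j =
      (\<Sum>S | card (- S) = j. principal_minor A S * l ^ card (- S))" for j
    by (simp add: e_coeff_def sum_distrib_right)
  moreover have "(\<Sum>j\<le>N. \<Sum>S\<in>{S\<in>UNIV. card (- S) = j}. principal_minor A S * l ^ card (- S)) =
      (\<Sum>S\<in>UNIV. principal_minor A S * l ^ card (- S))"
    using assms by (intro sum.group) (auto intro: order.trans[OF card_mono[of UNIV]])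
  ultimately show ?thesis
    by (simp add: det_mat_add_subsets)
qed

lemma e_coeff_card: "e_coeff (int CARD('n)) (A::real^'n^'n) = det A"
proof -
  have "{S::'n set. card S = CARD('n)} = {UNIV}"
    using card_subset_eq[of "UNIV :: 'n set"] by auto
  then show ?thesis
    by (simp add: e_coeff_def principal_minor_def det_def)
qed

lemma det_mat_add_low_order:
  fixes A :: "real^'n^'n"
  obtains h M where "\<And>l. \<bar>l\<bar> < 1 \<Longrightarrow> \<bar>h l\<bar> \<le> M"
    and "\<And>l. det (mat l + A) = det A + e_coeff (int CARD('n) - 1) A * l
      + l\<^sup>2 * (e_coeff (int CARD('n) - 2) A + e_coeff (int CARD('n) - 3) A * l + l\<^sup>2 * h l)"
proof
  define n where "n = CARD('n)"
  let ?h = "\<lambda>l. \<Sum>j\<le>n. e_coeff (int n - 4 - int j) A * l ^ j"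
  show "\<bar>?h l\<bar> \<le> (\<Sum>j\<le>n. \<bar>e_coeff (int n - 4 - int j) A\<bar>)" if "\<bar>l\<bar> < 1" for l
    using that
    by (intro sum_abs[THEN order.trans] sum_mono)
      (auto simp: abs_mult power_abs intro!: mult_left_le power_le_one)
  show "det (mat l + A) = det A + e_coeff (int CARD('n) - 1) A * l
      + l\<^sup>2 * (e_coeff (int CARD('n) - 2) A + e_coeff (int CARD('n) - 3) A * l + l\<^sup>2 * ?h l)" for l
    \<comment> \<open>With \<open>N = n + 4\<close>, four terms can be peeled off for every
      dimension, and the tail divided by \<open>l ^ 4\<close> is exactly
      \<open>?h l\<close>.\<close>
    using det_mat_add[where N="Suc (Suc (Suc (Suc n)))" and A=A and l=l] unfolding n_def[symmetric]
    by (simp add: sum.atMost_Suc_shift sum_distrib_left algebra_simps e_coeff_card[of A, folded n_def]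
      power2_eq_square diff_diff_eq del: sum.atMost_Suc)
qed

text \<open>Jacobi's formula at the identity matrix. A permutation other than \<open>id\<close>
  moves at least two indices, so after one factor has been differentiated an off-diagonal zero
  remains among the others.\<close>

lemma has_derivative_det_trace:
  fixes M :: "'a::real_normed_vector \<Rightarrow> real^'n^'n"
  assumes M: "(M has_derivative M') (at x)" and x: "M x = mat 1"
  shows "((\<lambda>y. det (M y)) has_derivative (\<lambda>h. trace (M' h))) (at x)"
proof -
  have comp: "((\<lambda>y. M y $ i $ j) has_derivative (\<lambda>h. M' h $ i $ j)) (at x)" for i j
    by (intro bounded_linear.has_derivative[OF bounded_linear_vec_nth] M)
  have "((\<lambda>y. det (M y)) has_derivative (\<lambda>h. \<Sum>\<pi> | \<pi> permutes UNIV. of_int (sign \<pi>) *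
      (\<Sum>i\<in>UNIV. M' h $ i $ \<pi> i * (\<Prod>j\<in>UNIV - {i}. M x $ j $ \<pi> j)))) (at x)"
    unfolding det_def by (intro has_derivative_sum has_derivative_mult_right has_derivative_prod comp)
  moreover have "(\<Sum>\<pi> | \<pi> permutes UNIV. of_int (sign \<pi>) *
      (\<Sum>i\<in>UNIV. M' h $ i $ \<pi> i * (\<Prod>j\<in>UNIV - {i}. M x $ j $ \<pi> j))) = trace (M' h)" for h
  proof -
    have "(\<Prod>j\<in>UNIV - {i}. M x $ j $ \<pi> j) = (if \<pi> = id then 1 else 0)"
      if \<pi>: "\<pi> permutes UNIV" for \<pi> and i :: 'n
    proof (cases "\<pi> = id")
      case True
      then show ?thesis by (simp add: x mat_def)
    next
      case False
      then have "\<not> \<pi> permutes {i}" by simp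
      then obtain j where "j \<noteq> i" "\<pi> j \<noteq> j"
        using permutes_superset[OF \<pi>, of "{i}"] by auto
      with False show ?thesis
        by (auto simp: x mat_def intro!: bexI[of _ j])
    qed
    note prod_eq = this
    have "(\<Sum>\<pi> | \<pi> permutes UNIV. of_int (sign \<pi>) *
        (\<Sum>i\<in>UNIV. M' h $ i $ \<pi> i * (\<Prod>j\<in>UNIV - {i}. M x $ j $ \<pi> j))) =
      (\<Sum>\<pi> | \<pi> permutes (UNIV :: 'n set). if \<pi> = id then \<Sum>i\<in>UNIV. M' h $ i $ i else 0)"
      by (rule sum.cong[OF refl]) (simp add: prod_eq)
    also have "\<dots> = trace (M' h)"
      by (simp add: trace_def)
    finally show ?thesis .
  qed
  ultimately show ?thesis by simp
qed

lemma matrix_add_rdistrib: "(A + B) ** C = A ** C + B ** C" for A :: "real^'n^'m"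
  by (simp add: vec_eq_iff matrix_matrix_mult_def sum.distrib algebra_simps)

text \<open>The matrix determinant lemma. An orthogonal change of basis turns \<open>y\<close> into
  a multiple of a basis vector; the update then alters a single column, and Cramer's rule gives the
  determinant.\<close>

lemma det_mat_1_add_rank_one:
  fixes x y :: "real^'n"
  shows "det (mat 1 + (\<chi> i j. x $ i * y $ j)) = 1 + y \<bullet> x"
proof (cases "y = 0")
  case True
  then show ?thesis by (simp add: zero_vec_def[symmetric])
next
  case False
  \<comment> \<open>Any fixed index serves here.\<close>
  define k :: 'n where "k = undefined"
  define a where "a = (1 / norm y) *\<^sub>R y"
  have "norm a = 1" using False by (simp add: a_def)
  then obtain Q where Q: "orthogonal_matrix Q" "Q *v axis k 1 = a"
    using orthogonal_matrix_exists_basis by metis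
  then have QQ: "transpose Q ** Q = mat 1" "Q ** transpose Q = mat 1"
    by (auto simp: orthogonal_matrix_def)
  define z where "z = transpose Q *v x"
  have y: "y = norm y *\<^sub>R (Q *v axis k 1)" using Q False by (simp add: a_def)
  have "transpose Q *v y = norm y *\<^sub>R axis k 1"
    by (subst y) (simp add: matrix_vector_mult_scaleR matrix_vector_mul_assoc QQ
      del: transpose_matrix_vector)
  then have ty: "y v* Q = norm y *\<^sub>R axis k 1" by simp
  have conj: "transpose Q ** (\<chi> i j. x $ i * y $ j) ** Q = (\<chi> i j. z $ i * (y v* Q) $ j)"
    by (simp add: vec_eq_iff matrix_matrix_mult_def z_def matrix_vector_mult_def vector_matrix_mult_def transpose_def
      sum_distrib_left sum_distrib_right algebra_simps)
  have "det (mat 1 + (\<chi> i j. x $ i * y $ j)) =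
      det (transpose Q ** (mat 1 + (\<chi> i j. x $ i * y $ j)) ** Q)"
    using arg_cong[OF QQ(1), of det] by (simp add: det_mul mult.commute mult.left_commute)
  also have "transpose Q ** (mat 1 + (\<chi> i j. x $ i * y $ j)) ** Q =
      mat 1 + (\<chi> i j. z $ i * (y v* Q) $ j)"
    by (simp add: matrix_add_ldistrib matrix_add_rdistrib conj QQ)
  also have "\<dots> = (\<chi> i j. if j = k then (mat 1 *v (axis k 1 + norm y *\<^sub>R z)) $ i else mat 1 $ i $ j)"
    unfolding matrix_vector_mul_lid by (simp add: vec_eq_iff ty mat_def axis_def)
  also have "det \<dots> = 1 + norm y * z $ k"
    by (subst cramer_lemma) (simp add: det_I)
  also have "norm y * z $ k = z \<bullet> (y v* Q)"
    by (simp add: ty inner_axis)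
  also have "\<dots> = y \<bullet> (Q *v (transpose Q *v x))"
    by (simp only: z_def dot_lmul_matrix inner_commute)
  also have "\<dots> = y \<bullet> x"
    by (simp add: matrix_vector_mul_assoc QQ del: transpose_matrix_vector)
  finally show ?thesis .
qed

section \<open>Resolvent bounds, linear systems and comparison of coefficients\<close>

lemma mat_add_vector_mult: "(mat l + A) *v x = l *\<^sub>R x + A *v x" for A :: "real^'n^'n"
  by (simp add: vec_eq_iff matrix_vector_mult_def mat_def if_distrib[of "\<lambda>x. x * _"]
    distrib_right sum.distrib cong: if_cong)

text \<open>An injective \<open>K\<close> is bounded below by some \<open>c\<close>, and a shift by
  less than \<open>c / 2\<close> uses up at most half of that bound. This makes the inverses of
  \<open>mat l + K\<close> uniformly bounded near \<open>l = 0\<close>.\<close>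

lemma resolvent_bound:
  fixes K :: "real^'n^'n"
  assumes "\<And>x. K *v x = 0 \<Longrightarrow> x = 0"
  obtains B r where "B > 0" "r > 0"
    "\<And>l x. \<bar>l\<bar> < r \<Longrightarrow> norm x \<le> B * norm ((mat l + K) *v x)"
proof -
  have "linear ((*v) K)" "inj ((*v) K)"
    using assms by (auto simp: linear_injective_0)
  then obtain c where c: "c > 0" "\<And>x. c * norm x \<le> norm (K *v x)"
    by (metis linear_inj_bounded_below_pos)
  have "norm x \<le> (2 / c) * norm ((mat l + K) *v x)" if l: "\<bar>l\<bar> < c / 2" for l x
  proof -
    have "\<bar>l\<bar> * norm x \<le> c / 2 * norm x"
      using l by (intro mult_right_mono) auto
    moreover have "norm (K *v x) \<le> norm ((mat l + K) *v x) + \<bar>l\<bar> * norm x"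
      using norm_triangle_ineq4[of "(mat l + K) *v x" "l *\<^sub>R x"] by (simp add: mat_add_vector_mult)
    ultimately have "c / 2 * norm x \<le> norm ((mat l + K) *v x)"
      using c(2)[of x] by linarith
    then show ?thesis using c(1) by (simp add: field_simps)
  qed
  then show thesis using c(1) that[of "2 / c" "c / 2"] by simp
qed

lemma matrix_solve:
  fixes K :: "real^'n^'n"
  assumes "\<And>x. K *v x = 0 \<Longrightarrow> x = 0"
  shows "\<exists>x. K *v x = y" "\<exists>x. x v* K = y" "det K \<noteq> 0" "x v* K = 0 \<Longrightarrow> x = 0"
proof -
  obtain L where L: "L ** K = mat 1" "K ** L = mat 1"
    using assms matrix_left_invertible_ker[of K] matrix_left_right_inverse by blast
  show "\<exists>x. K *v x = y" by (rule exI[of _ "L *v y"]) (simp add: matrix_vector_mul_assoc L)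
  show "\<exists>x. x v* K = y" by (rule exI[of _ "y v* L"]) (simp add: vector_matrix_mul_assoc L)
  show "det K \<noteq> 0" using L invertible_det_nz invertible_def by blast
  show "x = 0" if "x v* K = 0"
    using that vector_matrix_mul_assoc[of x K L] by (simp add: L)
qed

text \<open>Letting \<open>l\<close> tend to 0 from the right removes \<open>x\<close>; dividing by
  \<open>l\<close> and repeating removes \<open>y\<close>. This justifies comparing the coefficients
  of 1 and \<open>l\<close> when the remainder is only known to be bounded.\<close>

lemma affine_eq_0_if_quadratically_small:
  fixes x y :: real
  assumes "r > 0" and bound: "\<And>l. 0 < l \<Longrightarrow> l < r \<Longrightarrow> \<bar>x + y * l\<bar> \<le> l\<^sup>2 * M"
  shows "x = 0" "y = 0"
proof -
  have ev: "\<forall>\<^sub>F l in at_right 0. 0 < l \<and> l < r"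
    using \<open>r > 0\<close> by (auto simp: eventually_at_right_field)
  have "((\<lambda>l. x + y * l) \<longlongrightarrow> 0) (at_right 0)"
  proof (rule Lim_null_comparison)
    show "\<forall>\<^sub>F l in at_right 0. norm (x + y * l) \<le> l\<^sup>2 * M"
      using ev by eventually_elim (simp add: bound)
    show "((\<lambda>l. l\<^sup>2 * M) \<longlongrightarrow> 0) (at_right 0)" by (auto intro!: tendsto_eq_intros)
  qed
  moreover have "((\<lambda>l. x + y * l) \<longlongrightarrow> x) (at_right 0)"
    by (auto intro!: tendsto_eq_intros)
  ultimately show "x = 0" by (metis tendsto_unique trivial_limit_at_right_real)
  have "((\<lambda>l. y) \<longlongrightarrow> 0) (at_right (0::real))"
  proof (rule Lim_null_comparison)
    show "\<forall>\<^sub>F l in at_right 0. norm y \<le> l * M"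
      using ev
    proof eventually_elim
      case (elim l)
      then have "l * \<bar>y\<bar> \<le> l * (l * M)"
        using bound[of l] \<open>x = 0\<close> by (simp add: abs_mult power2_eq_square mult_ac)
      then show ?case using elim by simp
    qed
    show "((\<lambda>l. l * M) \<longlongrightarrow> 0) (at_right 0)" by (auto intro!: tendsto_eq_intros)
  qed
  then show "y = 0" by (simp add: tendsto_const_iff)
qed

subsection \<open>Jordan chains of length two\<close>

text \<open>A right Jordan chain together with the biorthogonal left chain, in which
  \<open>p1\<close> is the eigencovector and \<open>p0\<close> the generalized one. The last two
  conjuncts make both kernels one-dimensional.\<close>

definition jordan_chain :: "real^'n^'n \<Rightarrow> real^'n \<Rightarrow> real^'n \<Rightarrow> real^'n \<Rightarrow> real^'n \<Rightarrow> bool" where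
  "jordan_chain J q0 q1 p0 p1 \<longleftrightarrow>
     J *v q0 = 0 \<and> J *v q1 = q0 \<and> p1 v* J = 0 \<and> p0 v* J = p1 \<and>
     p0 \<bullet> q0 = 1 \<and> p1 \<bullet> q1 = 1 \<and> p0 \<bullet> q1 = 0 \<and> p1 \<bullet> q0 = 0 \<and>
     (\<forall>x. J *v x = 0 \<longrightarrow> (\<exists>s. x = s *\<^sub>R q0)) \<and> (\<forall>x. x v* J = 0 \<longrightarrow> (\<exists>s. x = s *\<^sub>R p1))"

lemma rank_one_mult: "(\<chi> i j. x $ i * y $ j) *v z = (y \<bullet> z) *\<^sub>R x" for x :: "real^'m" and y :: "real^'n"
  by (simp add: vec_eq_iff matrix_vector_mult_def inner_vec_def sum_distrib_left algebra_simps)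

text \<open>
  With \<open>u\<close> spanning the kernel of the transpose of \<open>J\<close>, the rank one update \<open>K = J + u \<nu>\<^sup>T\<close> is
  invertible, and the frame is built from \<open>K\<^sup>-\<^sup>1\<close>. The pairings come out right because
  \<open>det (l I + J) = det (l I + K) (1 - \<nu> \<bullet> (l I + K)\<^sup>-\<^sup>1 u)\<close>, expanded at \<open>l = 0\<close>, turns \<open>e\<^sub>n\<^sub>-\<^sub>1 = 0\<close>
  into \<open>\<nu> \<bullet> K\<^sup>-\<^sup>1 q0 = 0\<close> and \<open>e\<^sub>n\<^sub>-\<^sub>2 \<noteq> 0\<close> into \<open>\<nu> \<bullet> K\<^sup>-\<^sup>2 q0 \<noteq> 0\<close>.
\<close>

lemma jordan_chain_exists:
  fixes J :: "real^'n^'n"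
  assumes n: "CARD('n) \<ge> 2" and rank: "rank J = CARD('n) - 1"
    and e1: "e_coeff (int CARD('n) - 1) J = 0" and e2: "e_coeff (int CARD('n) - 2) J \<noteq> 0"
    and ker: "span {q0} = {v. J *v v = 0}"
  shows "\<exists>q1 p0 p1. jordan_chain J q0 q1 p0 p1"
proof -
  have ker0: "\<exists>s. x = s *\<^sub>R q0" if "J *v x = 0" for x
    using ker that by (auto simp: span_singleton)
  have J0: "J *v q0 = 0" using ker span_base[of q0 "{q0}"] by auto
  have "rank J < CARD('n)" using n rank by linarith
  then obtain x where "x \<noteq> 0" "J *v x = 0"
    using less_rank_noninjective[of J] by (auto simp: linear_injective_0)
  with ker0 have q0: "q0 \<noteq> 0" by force
  have "rank (transpose J) < CARD('n)" using \<open>rank J < _\<close> by (simp add: rank_transpose)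
  then obtain u where u: "u \<noteq> 0" "u v* J = 0"
    using less_rank_noninjective[of "transpose J"] by (auto simp: linear_injective_0)
  have detJ: "det J = 0"
    using \<open>x \<noteq> 0\<close> \<open>J *v x = 0\<close>
    by (metis invertible_def invertible_det_nz matrix_left_invertible_ker)
  \<comment> \<open>The scaling \<open>\<nu> \<bullet> q0 = 1\<close> yields
    \<open>K *v q0 = u\<close>, so \<open>u\<close>, \<open>q0\<close>, \<open>q1\<close>,
    \<open>q2\<close> become successive preimages under \<open>K\<close>.\<close>
  define \<nu> where "\<nu> = (1 / (q0 \<bullet> q0)) *\<^sub>R q0"
  have \<nu>: "\<nu> \<bullet> q0 = 1" using q0 by (simp add: \<nu>_def)
  define K where "K = J + (\<chi> i j. u $ i * \<nu> $ j)"
  have K: "K *v x = J *v x + (\<nu> \<bullet> x) *\<^sub>R u" for x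
    by (simp add: K_def vec_eq_iff matrix_vector_mult_def inner_vec_def distrib_right sum.distrib
      sum_distrib_left algebra_simps)
  have K': "x v* K = x v* J + (x \<bullet> u) *\<^sub>R \<nu>" for x
    by (simp add: K_def vec_eq_iff vector_matrix_mult_def inner_vec_def distrib_right sum.distrib
      sum_distrib_left algebra_simps)
  have inj: "x = 0" if "K *v x = 0" for x
  proof -
    \<comment> \<open>Since \<open>u\<close> annihilates the image of \<open>J\<close>, pairing
      \<open>K *v x\<close> with \<open>u\<close> isolates \<open>\<nu> \<bullet> x\<close>.\<close>
    have "u \<bullet> (J *v x) = 0" using u(2) by (simp add: dot_lmul_matrix[symmetric])
    then have "\<nu> \<bullet> x = 0"
      using u(1) arg_cong[OF that, of "\<lambda>y. u \<bullet> y"] by (simp add: K inner_add_right)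
    then have "J *v x = 0" using that by (simp add: K)
    then obtain s where "x = s *\<^sub>R q0" using ker0 by blast
    then show ?thesis using \<open>\<nu> \<bullet> x = 0\<close> \<nu> by simp
  qed
  have solve: "\<exists>x. K *v x = y" "\<exists>x. x v* K = y" "det K \<noteq> 0" "x v* K = 0 \<Longrightarrow> x = 0" for x y
    using matrix_solve[of K] inj by blast+
  have Kq0: "K *v q0 = u" using J0 \<nu> by (simp add: K)
  obtain q1 where q1: "K *v q1 = q0" using solve(1) by blast
  obtain q2 where q2: "K *v q2 = q1" using solve(1) by blast
  obtain B r where Br: "B > 0" "r > 0" "\<And>l x. \<bar>l\<bar> < r \<Longrightarrow> norm x \<le> B * norm ((mat l + K) *v x)"
    using resolvent_bound[of K] inj by blast
  have "\<exists>y. (mat l + K) *v y = q2" if "\<bar>l\<bar> < r" for l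
    by (rule matrix_solve(1)) (metis Br(3)[OF that] mult_zero_right norm_le_zero_iff norm_zero)
  then obtain y where y: "\<And>l. \<bar>l\<bar> < r \<Longrightarrow> (mat l + K) *v y l = q2" by metis
  have yb: "norm (y l) \<le> B * norm q2" if "\<bar>l\<bar> < r" for l
    using Br(3)[OF that, of "y l"] y[OF that] by simp
  obtain h M where h: "\<And>l. \<bar>l\<bar> < 1 \<Longrightarrow> \<bar>h l\<bar> \<le> M"
    and deth: "\<And>l. det (mat l + J) = l\<^sup>2 * (e_coeff (int CARD('n) - 2) J + e_coeff (int CARD('n) - 3) J * l + l\<^sup>2 * h l)"
    using det_mat_add_low_order[of J] detJ e1 by (metis add.left_neutral mult_zero_left)
  have detK: "det (mat l + J) = det (mat l + K) * (l * (\<nu> \<bullet> q1) - l\<^sup>2 * (\<nu> \<bullet> q2) + l ^ 3 * (\<nu> \<bullet> y l))"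
    if l: "\<bar>l\<bar> < r" for l
  proof -
    \<comment> \<open>The Neumann series of the resolvent of \<open>K\<close> applied to
      \<open>u\<close>, cut off after three terms; \<open>y l\<close> is the resolvent applied to
      \<open>q2\<close>, so the remainder is exact.\<close>
    define Y where "Y = q0 - l *\<^sub>R q1 + l\<^sup>2 *\<^sub>R q2 - l ^ 3 *\<^sub>R y l"
    have "K *v y l = q2 - l *\<^sub>R y l"
      using y[OF l, unfolded mat_add_vector_mult] by (simp add: eq_diff_eq add.commute)
    then have KY: "K *v Y = (u - l *\<^sub>R q0 + l\<^sup>2 *\<^sub>R q1) - l ^ 3 *\<^sub>R (q2 - l *\<^sub>R y l)"
      by (simp add: Y_def matrix_vector_right_distrib matrix_vector_mult_diff_distrib
        matrix_vector_mult_scaleR Kq0 q1 q2)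
    have "(mat l + K) *v Y = u"
      unfolding mat_add_vector_mult KY unfolding Y_def
      by (simp add: vec_eq_iff algebra_simps power2_eq_square power3_eq_cube)
    then have neg: "(mat l + K) *v (- Y) = - u"
      using matrix_vector_mult_diff_distrib[of "mat l + K" 0 Y] by simp
    \<comment> \<open>Pulling \<open>mat l + K\<close> out of the rank one perturbation reduces the
      determinant to the scalar \<open>1 - \<nu> \<bullet> Y\<close>.\<close>
    have "mat l + J = (mat l + K) ** (mat 1 + (\<chi> i j. (- Y) $ i * \<nu> $ j))"
      unfolding matrix_eq
    proof
      fix x
      have "(mat l + K) ** (mat 1 + (\<chi> i j. (- Y) $ i * \<nu> $ j)) *v x =
          (mat l + K) *v x + (\<nu> \<bullet> x) *\<^sub>R (- u)"
        by (simp only: matrix_vector_mul_assoc[symmetric] matrix_vector_mult_add_rdistrib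
          matrix_vector_mul_lid rank_one_mult matrix_vector_right_distrib
          matrix_vector_mult_scaleR flip: neg)
      also have "\<dots> = (mat l + J) *v x" by (simp add: mat_add_vector_mult K)
      finally show "(mat l + J) *v x =
          (mat l + K) ** (mat 1 + (\<chi> i j. (- Y) $ i * \<nu> $ j)) *v x" ..
    qed
    then have "det (mat l + J) = det (mat l + K) * (1 - \<nu> \<bullet> Y)"
      using det_mat_1_add_rank_one[of "- Y" \<nu>] by (simp add: det_mul)
    then show ?thesis
      by (simp add: Y_def inner_diff_right inner_add_right \<nu>)
  qed
  define D where "D l = det (mat l + K)" for l
  have "isCont D 0"
    unfolding D_def det_mat_add[OF order.refl] by (intro continuous_intros)
  then have "(D \<longlongrightarrow> D 0) (at_right 0)" by (simp add: isCont_def filterlim_at_split)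
  then have D: "(D \<longlongrightarrow> det K) (at_right 0)" by (simp add: D_def[of 0])
  have small: "\<forall>\<^sub>F l in at_right 0. 0 < l \<and> l < min r 1"
    using Br(2) by (auto simp: eventually_at_right_field intro!: exI[of _ "min r 1"])
  have "\<forall>\<^sub>F l in at_right 0. norm (\<nu> \<bullet> y l) \<le> norm \<nu> * (B * norm q2)"
    using small
    by eventually_elim (auto intro!: Cauchy_Schwarz_ineq2[THEN order.trans] mult_left_mono yb)
  then have lim_y: "((\<lambda>l. l ^ k * (\<nu> \<bullet> y l)) \<longlongrightarrow> 0) (at_right 0)" if "k > 0" for k
    by (rule lim_null_mult_right_bounded[rotated]) (use that in \<open>auto intro!: tendsto_eq_intros\<close>)
  have "\<forall>\<^sub>F l in at_right 0. norm (h l) \<le> M"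
    using small by eventually_elim (auto intro!: h)
  then have lim_h: "((\<lambda>l. l\<^sup>2 * h l) \<longlongrightarrow> 0) (at_right 0)"
    by (rule lim_null_mult_right_bounded[rotated]) (auto intro!: tendsto_eq_intros)
  define g where "g l = e_coeff (int CARD('n) - 2) J + e_coeff (int CARD('n) - 3) J * l + l\<^sup>2 * h l" for l
  have g: "(g \<longlongrightarrow> e_coeff (int CARD('n) - 2) J) (at_right 0)"
    unfolding g_def by (rule tendsto_eq_intros lim_h refl)+ simp
  \<comment> \<open>The two expansions of \<open>det (mat l + J)\<close> with one factor
    \<open>l\<close> cancelled. In the limit the right side vanishes, which forces
    \<open>\<nu> \<bullet> q1 = 0\<close>.\<close>
  have eq: "D l * (\<nu> \<bullet> q1 - l * (\<nu> \<bullet> q2) + l\<^sup>2 * (\<nu> \<bullet> y l)) = l * g l"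
    if "0 < l \<and> l < min r 1" for l
  proof -
    have "l * (D l * (\<nu> \<bullet> q1 - l * (\<nu> \<bullet> q2) + l\<^sup>2 * (\<nu> \<bullet> y l))) = l * (l * g l)"
      using detK[of l] deth[of l] that by (simp add: D_def g_def algebra_simps power2_eq_square power3_eq_cube)
    then show ?thesis using that by simp
  qed
  have "((\<lambda>l. l * g l) \<longlongrightarrow> det K * (\<nu> \<bullet> q1 - 0 * (\<nu> \<bullet> q2) + 0)) (at_right 0)"
    by (intro Lim_transform_eventually[OF _ eventually_mono[OF small eq]] tendsto_intros D lim_y) auto
  moreover have "((\<lambda>l. l * g l) \<longlongrightarrow> 0) (at_right 0)"
    by (auto intro!: tendsto_eq_intros g)
  ultimately have "det K * (\<nu> \<bullet> q1 - 0 * (\<nu> \<bullet> q2) + 0) = 0"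
    by (metis tendsto_unique trivial_limit_at_right_real)
  then have \<nu>q1: "\<nu> \<bullet> q1 = 0" using solve(3) by simp
  \<comment> \<open>A second factor \<open>l\<close> now cancels; the exponent in
    \<open>l ^ 1\<close> is kept so that \<open>lim_y\<close> applies.\<close>
  have eq': "D l * (- (\<nu> \<bullet> q2) + l ^ 1 * (\<nu> \<bullet> y l)) = g l" if "0 < l \<and> l < min r 1" for l
  proof -
    have "l * (D l * (- (\<nu> \<bullet> q2) + l * (\<nu> \<bullet> y l))) = l * g l"
      using eq[OF that] \<nu>q1 by (simp add: algebra_simps power2_eq_square)
    then show ?thesis using that by simp
  qed
  have "(g \<longlongrightarrow> det K * (- (\<nu> \<bullet> q2) + 0)) (at_right 0)"
    by (intro Lim_transform_eventually[OF _ eventually_mono[OF small eq']] tendsto_intros D lim_y) auto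
  then have "det K * (- (\<nu> \<bullet> q2) + 0) = e_coeff (int CARD('n) - 2) J"
    using g by (metis tendsto_unique trivial_limit_at_right_real)
  then have \<nu>q2: "\<nu> \<bullet> q2 \<noteq> 0" using e2 by auto
  \<comment> \<open>The left counterparts of \<open>q1\<close> and \<open>q2\<close>: moving
    \<open>K\<close> across the inner product reduces every pairing in \<open>dots\<close> to one
    with \<nu>.\<close>
  obtain w where w: "w v* K = \<nu>" using solve(2) by blast
  obtain z where z: "z v* K = w" using solve(2) by blast
  have dot: "x \<bullet> (K *v x') = (x v* K) \<bullet> x'" for x x' by (simp add: dot_lmul_matrix)
  have dots: "w \<bullet> u = 1" "w \<bullet> q0 = 0" "z \<bullet> u = 0" "w \<bullet> q1 = \<nu> \<bullet> q2" "z \<bullet> q0 = \<nu> \<bullet> q2"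
    using dot[of w q0] dot[of w q1] dot[of z q0] dot[of w q2] dot[of z q1]
    by (simp_all add: w z Kq0 q1 q2 \<nu> \<nu>q1)
  have wJ: "w v* J = 0" using w K'[of w] dots by simp
  have zJ: "z v* J = w" using z K'[of z] dots by simp
  have ker1: "\<exists>s. x = s *\<^sub>R w" if "x v* J = 0" for x
  proof -
    have "(x - (x \<bullet> u) *\<^sub>R w) v* K = 0"
      using that K'[of x] by (simp add: vector_matrix_mult_diff_distrib w scaleR_vector_matrix_assoc)
    then have "x - (x \<bullet> u) *\<^sub>R w = 0" by (rule solve(4))
    then show ?thesis by (intro exI[of _ "x \<bullet> u"]) simp
  qed
  define \<mu> where "\<mu> = \<nu> \<bullet> q2"
  have "\<mu> \<noteq> 0" using \<nu>q2 by (simp add: \<mu>_def)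
  have "J *v q1 = q0" using K[of q1] q1 \<nu>q1 by simp
  \<comment> \<open>Subtracting a multiple of \<open>w\<close> makes \<open>z\<close> orthogonal to
    \<open>q1\<close>. The pairing with \<open>q0\<close> is unaffected, since
    \<open>w \<bullet> q0 = 0\<close>, and division by \<mu> normalizes both covectors.\<close>
  then have "jordan_chain J q0 q1 ((1 / \<mu>) *\<^sub>R (z - ((z \<bullet> q1) / \<mu>) *\<^sub>R w)) ((1 / \<mu>) *\<^sub>R w)"
    unfolding jordan_chain_def
  proof (intro conjI allI impI)
    fix x assume "x v* J = 0"
    then obtain s where "x = s *\<^sub>R w" using ker1 by blast
    then show "\<exists>s. x = s *\<^sub>R (1 / \<mu>) *\<^sub>R w" using \<open>\<mu> \<noteq> 0\<close> by (intro exI[of _ "s * \<mu>"]) simp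
  qed (use J0 ker0 \<open>\<mu> \<noteq> 0\<close> in \<open>simp_all add: vector_matrix_mult_diff_distrib wJ zJ dots inner_diff_left
    \<mu>_def[symmetric] scaleR_vector_matrix_assoc\<close>)
  then show ?thesis by blast
qed

section \<open>Frames and the coefficient pair\<close>

lemma jordan_chain_bt_frame:
  assumes "jordan_chain J q0 q1 p0 p1"
  shows "bt_frame J q0 q1 p0 p1"
proof -
  note c = assms[unfolded jordan_chain_def]
  have "p0 v* (J ** J) = 0" "p1 v* (J ** J) = 0"
    using c by (simp_all flip: vector_matrix_mul_assoc)
  then have "p0 \<bullet> ((J ** J) *v x) = 0" "p1 \<bullet> ((J ** J) *v x) = 0" for x
    by (simp_all flip: dot_lmul_matrix)
  then show ?thesis
    using c by (auto simp: bt_frame_def center_space_def transverse_space_def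
      simp flip: matrix_vector_mul_assoc)
qed

text \<open>The kernel of \<open>J\<close> is spanned by \<open>q0\<close>, which limits the freedom
  in \<open>q1\<close> to a shift \<open>s\<close>. The annihilator of the image of the square of
  \<open>J\<close> is spanned by \<open>p0\<close> and \<open>p1\<close>, and biorthogonality then
  fixes the covectors.\<close>

lemma bt_frame_change:
  assumes chain: "jordan_chain J q0 q1 p0 p1" and frame: "bt_frame J q0 q1' p0' p1'"
  shows "\<exists>s. q1' = q1 + s *\<^sub>R q0 \<and> p1' = p1 \<and> p0' = p0 - s *\<^sub>R p1"
proof -
  note c = chain[unfolded jordan_chain_def] and f = frame[unfolded bt_frame_def]
  have "J *v (q1' - q1) = 0" using c f by (simp add: matrix_vector_mult_diff_distrib)
  then obtain s where "q1' - q1 = s *\<^sub>R q0" using c by blast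
  then have s: "q1' = q1 + s *\<^sub>R q0" by (simp add: algebra_simps)
  \<comment> \<open>Such an \<open>x\<close> is killed by applying \<open>J\<close> twice from the
    right; the one-dimensional left kernel of \<open>J\<close> is used once for each
    application.\<close>
  have span: "\<exists>\<alpha> \<beta>. x = \<alpha> *\<^sub>R p0 + \<beta> *\<^sub>R p1" if "\<And>v. v \<in> transverse_space J \<Longrightarrow> x \<bullet> v = 0" for x
  proof -
    have "(x v* J v* J) \<bullet> v = 0" for v
      using that[of "(J ** J) *v v"]
      by (simp add: transverse_space_def dot_lmul_matrix matrix_vector_mul_assoc)
    then have "x v* J v* J = 0" by (metis inner_eq_zero_iff)
    then obtain \<alpha> where "x v* J = \<alpha> *\<^sub>R p1" using c by blast
    then have "(x - \<alpha> *\<^sub>R p0) v* J = 0"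
      using c by (simp add: vector_matrix_mult_diff_distrib scaleR_vector_matrix_assoc)
    then obtain \<beta> where "x - \<alpha> *\<^sub>R p0 = \<beta> *\<^sub>R p1" using c by blast
    then show ?thesis by (metis add.commute diff_eq_eq)
  qed
  obtain \<alpha> \<beta> where p0': "p0' = \<alpha> *\<^sub>R p0 + \<beta> *\<^sub>R p1" using span f by metis
  obtain \<gamma> \<epsilon> where p1': "p1' = \<gamma> *\<^sub>R p0 + \<epsilon> *\<^sub>R p1" using span f by metis
  have "\<alpha> = 1" "\<gamma> = 0" using c f p0' p1' by (auto simp: inner_add_left)
  moreover from this have "\<epsilon> = 1" "\<beta> = - s"
    using c f p0' p1' s by (auto simp: inner_add_left inner_add_right)
  ultimately show ?thesis using s p0' p1' by auto
qed

text \<open>Changing the frame by \<open>s\<close> subtracts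
  \<open>s * (p1 \<bullet> D2X X p q0 q0)\<close> from the first summand of the second coefficient
  and adds it to the other, so the definite description is well defined.\<close>

lemma bt_coefficients_eq:
  assumes "jordan_chain (DX X p) q0 q1 p0 p1"
  shows "bt_coefficients X p q0 =
    (1/2 * (p1 \<bullet> D2X X p q0 q0), p0 \<bullet> D2X X p q0 q0 + p1 \<bullet> D2X X p q0 q1)"
  unfolding bt_coefficients_def
proof (rule the_equality)
  fix ab
  assume "\<exists>q1 p0 p1. bt_frame (DX X p) q0 q1 p0 p1 \<and>
    ab = (1/2 * (p1 \<bullet> D2X X p q0 q0), p0 \<bullet> D2X X p q0 q0 + p1 \<bullet> D2X X p q0 q1)"
  then obtain q1' p0' p1' where frame: "bt_frame (DX X p) q0 q1' p0' p1'"
    and ab: "ab = (1/2 * (p1' \<bullet> D2X X p q0 q0), p0' \<bullet> D2X X p q0 q0 + p1' \<bullet> D2X X p q0 q1')"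
    by blast
  from bt_frame_change[OF assms frame]
  show "ab = (1/2 * (p1 \<bullet> D2X X p q0 q0), p0 \<bullet> D2X X p q0 q0 + p1 \<bullet> D2X X p q0 q1)"
    by (auto simp: ab D2X_def matrix_vector_right_distrib matrix_vector_mult_scaleR
      inner_add_right inner_diff_left)
qed (use jordan_chain_bt_frame[OF assms] in blast)

text \<open>The trace of the rank one matrix with column \<open>q\<close> and row \<open>p\<close>,
  multiplied by \<open>A\<close>, computed column by column.\<close>

lemma inner_matrix_vector_eq_sum_columns:
  fixes A :: "real^'n^'m"
  shows "(\<Sum>i\<in>UNIV. (p \<bullet> (A *v axis i 1)) * q $ i) = p \<bullet> (A *v q)"
proof -
  have "A *v q = (\<Sum>i\<in>UNIV. q $ i *\<^sub>R (A *v axis i 1))"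
    using arg_cong[OF basis_expansion[of q], of "\<lambda>v. A *v v"]
    by (simp add: linear_sum[OF matrix_vector_mul_linear] scalar_mult_eq_scaleR matrix_vector_mult_scaleR)
  then show ?thesis by (simp add: inner_sum_right mult.commute)
qed

text \<open>On the span of \<open>q0\<close> and \<open>q1\<close> the resolvent \<open>L\<close> is
  explicit, with poles of order at most two at \<open>l = 0\<close>. On the complement it stays
  bounded, so after multiplication by \<open>l\<^sup>2\<close> that part of the trace is absorbed in
  the error.\<close>

lemma jordan_chain_trace_resolvent:
  fixes J A :: "real^'n^'n"
  assumes chain: "jordan_chain J q0 q1 p0 p1"
  obtains r M where "r > 0"
    "\<And>l L. 0 < l \<Longrightarrow> l < r \<Longrightarrow> (mat l + J) ** L = mat 1 \<Longrightarrow>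
      \<bar>l\<^sup>2 * trace (L ** A) - (l * (p0 \<bullet> (A *v q0) + p1 \<bullet> (A *v q1)) - p1 \<bullet> (A *v q0))\<bar> \<le> l\<^sup>2 * M"
proof -
  note c = chain[unfolded jordan_chain_def]
  define P where "P x = (p0 \<bullet> x) *\<^sub>R q0 + (p1 \<bullet> x) *\<^sub>R q1" for x
  \<comment> \<open>Adding the projection \<open>P\<close> makes the nilpotent block invertible and
    leaves \<open>J\<close> unchanged where \<open>P\<close> vanishes, so the bound for
    \<open>K\<close> controls \<open>L\<close> there.\<close>
  define K where "K = J + (\<chi> i j. q0 $ i * p0 $ j) + (\<chi> i j. q1 $ i * p1 $ j)"
  have K: "K *v x = J *v x + P x" for x
    by (simp add: K_def P_def rank_one_mult matrix_vector_mult_add_rdistrib)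
  have dotJ: "p0 \<bullet> (J *v x) = p1 \<bullet> x" "p1 \<bullet> (J *v x) = 0" for x
    using c by (simp_all flip: dot_lmul_matrix)
  have dotP: "p0 \<bullet> P x = p0 \<bullet> x" "p1 \<bullet> P x = p1 \<bullet> x" for x
    using c by (simp_all add: P_def inner_add_right)
  have inj: "x = 0" if "K *v x = 0" for x
  proof -
    have "p1 \<bullet> x = 0" using arg_cong[OF that, of "\<lambda>y. p1 \<bullet> y"] by (simp add: K inner_add_right dotJ dotP)
    moreover from this have p0x: "p0 \<bullet> x = 0"
      using arg_cong[OF that, of "\<lambda>y. p0 \<bullet> y"] by (simp add: K inner_add_right dotJ dotP)
    ultimately have "J *v x = 0" using that by (simp add: K P_def)
    then obtain s where "x = s *\<^sub>R q0" using c by blast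
    then show ?thesis using p0x c by simp
  qed
  obtain B r where Br: "B > 0" "r > 0" "\<And>l x. \<bar>l\<bar> < r \<Longrightarrow> norm x \<le> B * norm ((mat l + K) *v x)"
    using resolvent_bound[of K] inj by blast
  define R where "R i = A *v axis i 1 - P (A *v axis i 1)" for i
  have "\<bar>l\<^sup>2 * trace (L ** A) - (l * (p0 \<bullet> (A *v q0) + p1 \<bullet> (A *v q1)) - p1 \<bullet> (A *v q0))\<bar>
      \<le> l\<^sup>2 * (\<Sum>i\<in>UNIV. B * norm (R i))"
    if l: "0 < l" "l < r" and L: "(mat l + J) ** L = mat 1" for l L
  proof -
    have L': "L ** (mat l + J) = mat 1" using L matrix_left_right_inverse by blast
    have sol: "L *v ((mat l + J) *v x) = x" for x by (simp add: matrix_vector_mul_assoc L')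
    have Lq0: "l *\<^sub>R (L *v q0) = q0"
      using sol[of q0] c by (simp add: mat_add_vector_mult matrix_vector_mult_scaleR)
    have "l *\<^sub>R (L *v q1) + L *v q0 = q1"
      using sol[of q1] c by (simp add: mat_add_vector_mult matrix_vector_mult_scaleR matrix_vector_right_distrib)
    then have "l *\<^sub>R (l *\<^sub>R (L *v q1) + L *v q0) = l *\<^sub>R q1" by simp
    then have Lq1: "l\<^sup>2 *\<^sub>R (L *v q1) = l *\<^sub>R q1 - q0"
      unfolding scaleR_add_right Lq0 by (simp add: power2_eq_square eq_diff_eq)
    \<comment> \<open>Pairing with \<open>p1\<close> and then with \<open>p0\<close> shows that
      \<open>L\<close> preserves the kernel of \<open>P\<close>, on which \<open>mat l + J\<close>
      and \<open>mat l + K\<close> agree.\<close>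
    have bound: "norm (L *v (x - P x)) \<le> B * norm (x - P x)" for x
    proof -
      define y where "y = L *v (x - P x)"
      have "(mat l + J) *v y = x - P x"
        by (simp add: y_def matrix_vector_mul_assoc L)
      then have y: "l *\<^sub>R y + J *v y = x - P x"
        by (simp add: mat_add_vector_mult)
      have "l * (p1 \<bullet> y) = 0"
        using arg_cong[OF y, of "\<lambda>z. p1 \<bullet> z"] by (simp add: inner_add_right inner_diff_right dotJ dotP)
      moreover have "l * (p0 \<bullet> y) + p1 \<bullet> y = 0"
        using arg_cong[OF y, of "\<lambda>z. p0 \<bullet> z"] by (simp add: inner_add_right inner_diff_right dotJ dotP)
      ultimately have "P y = 0" using l by (simp add: P_def)
      then have "(mat l + K) *v y = x - P x" using y by (simp add: mat_add_vector_mult K)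
      then show ?thesis using Br(3)[of l y] l by (simp add: y_def)
    qed
    have Lx: "l\<^sup>2 *\<^sub>R (L *v x) = l *\<^sub>R ((p0 \<bullet> x) *\<^sub>R q0) + (p1 \<bullet> x) *\<^sub>R (l *\<^sub>R q1 - q0) + l\<^sup>2 *\<^sub>R (L *v (x - P x))" for x
    proof -
      have "l\<^sup>2 *\<^sub>R (L *v P x) = l *\<^sub>R (p0 \<bullet> x) *\<^sub>R (l *\<^sub>R (L *v q0)) + (p1 \<bullet> x) *\<^sub>R (l\<^sup>2 *\<^sub>R (L *v q1))"
        by (simp add: P_def matrix_vector_right_distrib matrix_vector_mult_scaleR scaleR_add_right
          power2_eq_square mult.commute mult.left_commute)
      then show ?thesis by (simp add: Lq0 Lq1 matrix_vector_mult_diff_distrib scaleR_diff_right)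
    qed
    \<comment> \<open>Reading the trace off the columns of \<open>A\<close> allows \<open>Lx\<close>
      to be applied to each column separately.\<close>
    have "l\<^sup>2 * trace (L ** A) = (\<Sum>i\<in>UNIV. (l\<^sup>2 *\<^sub>R (L *v (A *v axis i 1))) $ i)"
      unfolding matrix_vector_mult_basis
      by (simp add: trace_def sum_distrib_left column_def matrix_matrix_mult_def matrix_vector_mult_def)
    also have "\<dots> = l * (p0 \<bullet> (A *v q0)) + (l * (p1 \<bullet> (A *v q1)) - p1 \<bullet> (A *v q0)) + l\<^sup>2 * (\<Sum>i\<in>UNIV. (L *v R i) $ i)"
    proof -
      have "(l\<^sup>2 *\<^sub>R (L *v (A *v axis i 1))) $ i = l * ((p0 \<bullet> (A *v axis i 1)) * q0 $ i)
          + (l * ((p1 \<bullet> (A *v axis i 1)) * q1 $ i) - (p1 \<bullet> (A *v axis i 1)) * q0 $ i)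
          + l\<^sup>2 * (L *v R i) $ i" for i
        by (subst Lx) (simp add: R_def right_diff_distrib mult.left_commute)
      then show ?thesis
        by (simp only: sum.distrib sum_subtractf sum_distrib_left[symmetric]
          inner_matrix_vector_eq_sum_columns)
    qed
    finally have "\<bar>l\<^sup>2 * trace (L ** A) - (l * (p0 \<bullet> (A *v q0) + p1 \<bullet> (A *v q1)) - p1 \<bullet> (A *v q0))\<bar> =
        l\<^sup>2 * \<bar>\<Sum>i\<in>UNIV. (L *v R i) $ i\<bar>"
      by (simp add: algebra_simps abs_mult)
    also have "\<bar>\<Sum>i\<in>UNIV. (L *v R i) $ i\<bar> \<le> (\<Sum>i\<in>UNIV. B * norm (R i))"
      unfolding R_def
      by (intro sum_abs[THEN order.trans] sum_mono component_le_norm_cart[THEN order.trans] bound)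
    finally show ?thesis by (simp add: mult_left_mono)
  qed
  then show thesis using that[of r] Br(2) by blast
qed

subsection \<open>Continuously differentiable functions and their zero sets\<close>

lemma C1_onI:
  fixes f' :: "'a::real_normed_vector \<Rightarrow> 'a \<Rightarrow>\<^sub>L 'b::real_normed_vector"
  assumes "\<And>x. x \<in> U \<Longrightarrow> (f has_derivative f' x) (at x)" and "continuous_on U f'"
  shows "C1_on U f"
  using assms unfolding C1_on_def by blast

lemma C1_on_imp_continuous_on: "C1_on U f \<Longrightarrow> continuous_on U f"
  unfolding C1_on_def by (meson continuous_at_imp_continuous_on has_derivative_continuous)

lemma C1_on_imp_has_derivative:
  assumes "C1_on U f" "x \<in> U"
  shows "(f has_derivative frechet_derivative f (at x)) (at x)"
  using assms unfolding C1_on_def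
  by (metis differentiable_def frechet_derivative_works)

lemma C1_on_subset: "C1_on U f \<Longrightarrow> V \<subseteq> U \<Longrightarrow> C1_on V f"
  unfolding C1_on_def by (meson continuous_on_subset subsetD)

lemma C1_on_cong_open:
  assumes "open U" "\<And>x. x \<in> U \<Longrightarrow> f x = g x" "C1_on U f"
  shows "C1_on U g"
proof -
  obtain f' where f': "\<And>x. x \<in> U \<Longrightarrow> (f has_derivative blinfun_apply (f' x)) (at x)" "continuous_on U f'"
    using assms(3) unfolding C1_on_def by blast
  show ?thesis
    by (rule C1_onI[where f'=f'])
      (auto intro: has_derivative_transform_within_open[OF f'(1) assms(1)] simp: assms(2) f'(2))
qed

lemma C1_on_bounded_linear:
  assumes T: "bounded_linear T" and f: "C1_on U f"
  shows "C1_on U (\<lambda>x. T (f x))"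
proof -
  obtain f' where f': "\<And>x. x \<in> U \<Longrightarrow> (f has_derivative blinfun_apply (f' x)) (at x)" "continuous_on U f'"
    using f unfolding C1_on_def by blast
  show ?thesis
  proof (rule C1_onI[where f'="\<lambda>x. Blinfun T o\<^sub>L f' x"])
    show "((\<lambda>x. T (f x)) has_derivative blinfun_apply (Blinfun T o\<^sub>L f' x)) (at x)" if "x \<in> U" for x
      using bounded_linear.has_derivative[OF T f'(1)[OF that]]
      by (simp add: blinfun_compose.rep_eq bounded_linear_Blinfun_apply[OF T] o_def)
  qed (intro continuous_intros f'(2))
qed

lemma C1_on_const: "C1_on U (\<lambda>x. c)"
  by (rule C1_onI[where f'="\<lambda>x. 0"]) (simp_all add: zero_blinfun.rep_eq)

lemma C1_on_add:
  assumes "C1_on U f" "C1_on U g"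
  shows "C1_on U (\<lambda>x. f x + g x)"
proof -
  obtain f' g' where d: "\<And>x. x \<in> U \<Longrightarrow> (f has_derivative blinfun_apply (f' x)) (at x)" "continuous_on U f'"
      "\<And>x. x \<in> U \<Longrightarrow> (g has_derivative blinfun_apply (g' x)) (at x)" "continuous_on U g'"
    using assms unfolding C1_on_def by blast
  show ?thesis
    by (rule C1_onI[where f'="\<lambda>x. f' x + g' x"])
      (auto intro!: derivative_eq_intros d continuous_on_add simp: blinfun.add_left)
qed

lemma C1_on_mult:
  fixes f g :: "'a::real_normed_vector \<Rightarrow> real"
  assumes "C1_on U f" "C1_on U g"
  shows "C1_on U (\<lambda>x. f x * g x)"
proof -
  obtain f' g' where d: "\<And>x. x \<in> U \<Longrightarrow> (f has_derivative blinfun_apply (f' x)) (at x)" "continuous_on U f'"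
      "\<And>x. x \<in> U \<Longrightarrow> (g has_derivative blinfun_apply (g' x)) (at x)" "continuous_on U g'"
    using assms unfolding C1_on_def by blast
  show ?thesis
    by (rule C1_onI[where f'="\<lambda>x. f x *\<^sub>R g' x + g x *\<^sub>R f' x"])
      (auto intro!: derivative_eq_intros d continuous_on_add continuous_on_scaleR assms[THEN C1_on_imp_continuous_on]
        simp: blinfun.add_left blinfun.scaleR_left)
qed

lemma C1_on_inverse:
  fixes f :: "'a::real_normed_vector \<Rightarrow> real"
  assumes "C1_on U f" "\<And>x. x \<in> U \<Longrightarrow> f x \<noteq> 0"
  shows "C1_on U (\<lambda>x. inverse (f x))"
proof -
  obtain f' where d: "\<And>x. x \<in> U \<Longrightarrow> (f has_derivative blinfun_apply (f' x)) (at x)" "continuous_on U f'"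
    using assms unfolding C1_on_def by blast
  show ?thesis
    by (rule C1_onI[where f'="\<lambda>x. - ((inverse (f x) * inverse (f x)) *\<^sub>R f' x)"])
      (auto intro!: derivative_eq_intros d continuous_on_minus continuous_on_scaleR continuous_on_mult continuous_on_inverse
        assms(1)[THEN C1_on_imp_continuous_on]
        simp: blinfun.minus_left blinfun.scaleR_left assms(2))
qed

lemma C1_on_sum:
  assumes "\<And>i. i \<in> I \<Longrightarrow> C1_on U (f i)"
  shows "C1_on U (\<lambda>x. \<Sum>i\<in>I. f i x)"
  using assms by (induction I rule: infinite_finite_induct) (auto intro: C1_on_const C1_on_add)

lemma C1_on_prod:
  fixes f :: "'i \<Rightarrow> 'a::real_normed_vector \<Rightarrow> real"
  assumes "\<And>i. i \<in> I \<Longrightarrow> C1_on U (f i)"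
  shows "C1_on U (\<lambda>x. \<Prod>i\<in>I. f i x)"
  using assms by (induction I rule: infinite_finite_induct) (auto intro: C1_on_const C1_on_mult)

lemma C1_on_e_coeff:
  fixes M :: "'a::real_normed_vector \<Rightarrow> real^'n^'n"
  assumes "C1_on U M"
  shows "C1_on U (\<lambda>x. e_coeff k (M x))"
proof -
  have "bounded_linear (\<lambda>A :: real^'n^'n. A $ i $ j)" for i j
    by (rule bounded_linear_compose[OF bounded_linear_vec_nth bounded_linear_vec_nth])
  then have "C1_on U (\<lambda>x. M x $ i $ j)" for i j
    by (rule C1_on_bounded_linear) (rule assms)
  then show ?thesis
    unfolding e_coeff_def principal_minor_def
    by (intro C1_on_sum C1_on_mult C1_on_const C1_on_prod)
qed

text \<open>Passing from a derivative operator to its matrix is bounded linear, so regularity of the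
  operator-valued derivative carries over to the Jacobian matrix.\<close>

lemma C1_on_jacobian:
  fixes X :: "real^'n \<Rightarrow> real^'n"
  assumes "open U" "C2_on U X"
  shows "C1_on U (DX X)"
proof -
  obtain f' :: "real^'n \<Rightarrow> (real^'n) \<Rightarrow>\<^sub>L (real^'n)"
    where f': "\<And>x. x \<in> U \<Longrightarrow> (X has_derivative blinfun_apply (f' x)) (at x)" "C1_on U f'"
    using assms(2) unfolding C2_on_def by blast
  have "bounded_linear (\<lambda>F :: (real^'n) \<Rightarrow>\<^sub>L (real^'n). matrix (blinfun_apply F))"
  proof -
    have if_sum: "(\<Sum>j\<in>UNIV. if b then g j else 0) = (if b then \<Sum>j\<in>UNIV. g j else 0)"
      for b and g :: "'n \<Rightarrow> real" by simp
    \<comment> \<open>A finite sum of evaluation functionals times unit matrices, from which bounded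
      linearity is immediate.\<close>
    have "matrix (blinfun_apply F) = (\<Sum>i\<in>UNIV. \<Sum>j\<in>UNIV. (F (axis j 1) $ i) *\<^sub>R axis i (axis j 1))"
      for F :: "(real^'n) \<Rightarrow>\<^sub>L (real^'n)"
      by (simp add: vec_eq_iff matrix_def axis_def if_distrib[of "\<lambda>x. x $ _"] if_distrib[of "\<lambda>x. _ * x"]
        if_distribR if_sum cong: if_cong)
    moreover have "bounded_linear (\<lambda>F :: (real^'n) \<Rightarrow>\<^sub>L (real^'n). blinfun_apply F v $ i)" for v i
      by (rule bounded_linear_compose[OF bounded_linear_vec_nth blinfun.bounded_linear_left])
    ultimately show ?thesis
      by (auto intro!: bounded_linear_sum bounded_linear_scaleR_const)
  qed
  then have "C1_on U (\<lambda>x. matrix (blinfun_apply (f' x)))"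
    using f'(2) by (rule C1_on_bounded_linear)
  then show ?thesis
    by (rule C1_on_cong_open[OF assms(1), rotated])
      (simp add: jacobian_def frechet_derivative_at[OF f'(1)])
qed

section \<open>Regular zero sets as hypersurfaces\<close>

lemma C1_hypersurface_near_zero_set:
  fixes f :: "'a::euclidean_space \<Rightarrow> real"
  assumes "open D" "p \<in> D" "C1_on D f" "f p = 0" and q: "frechet_derivative f (at p) q \<noteq> 0"
  shows "C1_hypersurface_near {x\<in>D. f x = 0} p"
proof -
  obtain F :: "'a \<Rightarrow> 'a \<Rightarrow>\<^sub>L real"
    where F: "\<And>x. x \<in> D \<Longrightarrow> (f has_derivative blinfun_apply (F x)) (at x)" "continuous_on D F"
    using assms(3) unfolding C1_on_def by blast
  have Fq: "F p q \<noteq> 0"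
    using q frechet_derivative_at[OF F(1)[OF \<open>p \<in> D\<close>]] by simp
  define c where "c = (1 / norm q) *\<^sub>R q"
  have "q \<noteq> 0" using Fq blinfun.zero_right by metis
  then have cc: "c \<bullet> c = 1" and Fc: "F p c \<noteq> 0"
    using Fq by (auto simp: c_def blinfun.scaleR_right dot_square_norm power2_eq_square)
  \<comment> \<open>The part of \<open>D\<close> on which the derivative of the chart will be
    invertible.\<close>
  define E where "E = {x\<in>D. F x c \<noteq> 0}"
  have "open E"
  proof -
    have "continuous_on D (\<lambda>x. F x c)" by (intro continuous_intros F(2))
    then have "open (D \<inter> (\<lambda>x. F x c) -` (- {0}))"
      by (rule continuous_open_preimage[OF _ \<open>open D\<close>]) auto
    also have "D \<inter> (\<lambda>x. F x c) -` (- {0}) = E" by (auto simp: E_def)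
    finally show ?thesis .
  qed
  have "p \<in> E" "E \<subseteq> D" using \<open>p \<in> D\<close> Fc by (auto simp: E_def)
  have contF: "continuous_on E F" using F(2) \<open>E \<subseteq> D\<close> continuous_on_subset by blast
  \<comment> \<open>The \<open>c\<close>-coordinate of \<open>\<phi>\<close> is \<open>f\<close>, and \<open>D\<phi>\<close> is a rank one update of the identity, so its
    inverse \<open>\<Psi>\<close> is explicit and visibly continuous.\<close>
  define \<phi> where "\<phi> x = (x - p) + (f x - c \<bullet> (x - p)) *\<^sub>R c" for x
  have c\<phi>: "c \<bullet> \<phi> x = f x" for x
    by (simp add: \<phi>_def inner_add_right cc)
  define \<Phi> where "\<Phi> x = id_blinfun + (blinfun_scaleR_left c o\<^sub>L (F x - blinfun_inner_right c))" for x
  define \<Psi> where "\<Psi> x = id_blinfun - inverse (F x c) *\<^sub>R (blinfun_scaleR_left c o\<^sub>L (F x - blinfun_inner_right c))" for x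
  have \<Phi>: "\<Phi> x h = h + (F x h - c \<bullet> h) *\<^sub>R c"
    and \<Psi>: "\<Psi> x h = h - (inverse (F x c) * (F x h - c \<bullet> h)) *\<^sub>R c" for x h
    by (simp_all add: \<Phi>_def \<Psi>_def blinfun.add_left blinfun.diff_left blinfun.scaleR_left)
  have \<Phi>\<Psi>: "\<Phi> x (\<Psi> x h) = h" and \<Psi>\<Phi>: "\<Psi> x (\<Phi> x h) = h" if "x \<in> E" for x h
  proof -
    have Fxc: "F x c \<noteq> 0" using that by (simp add: E_def)
    define r where "r = inverse (F x c) * (F x h - c \<bullet> h)"
    have "r * F x c = F x h - c \<bullet> h"
      using Fxc by (simp add: r_def)
    then have "F x (\<Psi> x h) = c \<bullet> h" "c \<bullet> \<Psi> x h = c \<bullet> h - r"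
      by (simp_all add: \<Psi> blinfun.diff_right blinfun.scaleR_right inner_diff_right cc flip: r_def)
    then have "F x (\<Psi> x h) - c \<bullet> \<Psi> x h = r" by simp
    then show "\<Phi> x (\<Psi> x h) = h" unfolding \<Phi> by (simp add: \<Psi> r_def)
    have "F x (\<Phi> x h) = F x h + (F x h - c \<bullet> h) * F x c" "c \<bullet> \<Phi> x h = F x h"
      by (simp_all add: \<Phi> blinfun.add_right blinfun.scaleR_right inner_add_right cc)
    then have "inverse (F x c) * (F x (\<Phi> x h) - c \<bullet> \<Phi> x h) = F x h - c \<bullet> h"
      using Fxc by simp
    then show "\<Psi> x (\<Phi> x h) = h" unfolding \<Psi> by (simp add: \<Phi>)
  qed
  have der: "(\<phi> has_derivative \<Phi> x) (at x)" if "x \<in> E" for x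
  proof -
    have Fx: "(f has_derivative F x) (at x)" using F(1) that \<open>E \<subseteq> D\<close> by blast
    have "(\<phi> has_derivative (\<lambda>h. h + (F x h - c \<bullet> h) *\<^sub>R c)) (at x)"
      unfolding \<phi>_def by (auto intro!: derivative_eq_intros Fx)
    moreover have "blinfun_apply (\<Phi> x) = (\<lambda>h. h + (F x h - c \<bullet> h) *\<^sub>R c)"
      by (simp add: fun_eq_iff \<Phi>)
    ultimately show ?thesis by simp
  qed
  have cont\<Phi>: "continuous_on E \<Phi>"
    unfolding \<Phi>_def by (intro continuous_intros contF)
  have cont\<Psi>: "continuous_on E \<Psi>"
    unfolding \<Psi>_def by (intro continuous_intros contF) (auto simp: E_def)
  have "\<Psi> p o\<^sub>L \<Phi> p = id_blinfun"
    by (rule blinfun_eqI) (simp add: \<Psi>\<Phi>[OF \<open>p \<in> E\<close>])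
  from inverse_function_theorem[OF \<open>open E\<close> der cont\<Phi> \<open>p \<in> E\<close> this]
  obtain W V g g' where W: "open W" "W \<subseteq> E" "p \<in> W" "open V" and hom: "homeomorphism W V \<phi> g"
    and g: "\<And>y. y \<in> V \<Longrightarrow> (g has_derivative (g' y)) (at y)"
      "\<And>y. y \<in> V \<Longrightarrow> g' y = inv (blinfun_apply (\<Phi> (g y)))"
    by metis
  have gE: "g y \<in> E" if "y \<in> V" for y
    using homeomorphism_image2[OF hom] that W(2) by blast
  have "C1_on V g"
  \<comment> \<open>The inverse function theorem supplies the derivative of \<open>g\<close> only as
    an \<open>inv\<close>; identifying it with \<Psi> gives its continuity.\<close>
  proof (rule C1_onI[where f'="\<lambda>y. \<Psi> (g y)"])
    show "(g has_derivative blinfun_apply (\<Psi> (g y))) (at y)" if "y \<in> V" for y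
      using g[OF that] inv_equality[of "\<Psi> (g y)" "\<Phi> (g y)"] \<Phi>\<Psi> \<Psi>\<Phi> gE[OF that] by simp
    show "continuous_on V (\<lambda>y. \<Psi> (g y))"
      by (rule continuous_on_compose2[OF cont\<Psi> homeomorphism_cont2[OF hom]]) (use gE in blast)
  qed
  moreover have "C1_on W \<phi>"
    by (rule C1_on_subset[OF C1_onI[OF der cont\<Phi>] W(2)])
  moreover have "\<phi> ` ({x\<in>D. f x = 0} \<inter> W) = {y\<in>V. c \<bullet> y = 0}"
    using homeomorphism_image1[OF hom] W(2) \<open>E \<subseteq> D\<close> by (auto simp: c\<phi>)
  moreover have "c \<noteq> 0" using cc by auto
  ultimately show ?thesis
    unfolding C1_hypersurface_near_def using W hom assms(2,4) by blast
qed

subsection \<open>Derivatives of the characteristic coefficients\<close>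

text \<open>For small \<open>l > 0\<close> the derivative of \<open>det (mat l + M x)\<close> is
  computed twice: coefficientwise through \<open>E\<close>, and by Jacobi's formula. The factor
  \<open>l\<^sup>2\<close> of the determinant at \<open>p\<close> compensates the double pole of the
  resolvent trace, so the terms of order 1 and \<open>l\<close> can be compared.\<close>

lemma e_coeff_derivative_jordan_chain:
  fixes M :: "'a::real_normed_vector \<Rightarrow> real^'n^'n"
  assumes chain: "jordan_chain (M p) q0 q1 p0 p1"
    and det: "det (M p) = 0" and e1: "e_coeff (int CARD('n) - 1) (M p) = 0"
    and e2: "e_coeff (int CARD('n) - 2) (M p) \<noteq> 0"
    and M': "(M has_derivative M') (at p)"
    and E: "\<And>k. ((\<lambda>x. e_coeff k (M x)) has_derivative E k) (at p)"
  shows "E (int CARD('n)) v = - e_coeff (int CARD('n) - 2) (M p) * (p1 \<bullet> (M' v *v q0))"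
    and "E (int CARD('n) - 1) v =
      e_coeff (int CARD('n) - 2) (M p) * (p0 \<bullet> (M' v *v q0) + p1 \<bullet> (M' v *v q1))
        - e_coeff (int CARD('n) - 3) (M p) * (p1 \<bullet> (M' v *v q0))"
proof -
  define n where "n = CARD('n)"
  define J where "J = M p"
  define A where "A = M' v"
  define \<alpha> where "\<alpha> = p1 \<bullet> (A *v q0)"
  define \<beta> where "\<beta> = p0 \<bullet> (A *v q0) + p1 \<bullet> (A *v q1)"
  define c where "c = e_coeff (int n - 2) J"
  define c1 where "c1 = e_coeff (int n - 3) J"
  define m where "m l = (\<Sum>j\<le>n. E (int n - 2 - int j) v * l ^ j)" for l
  define M1 where "M1 = (\<Sum>j\<le>n. \<bar>E (int n - 2 - int j) v\<bar>)"
  have m: "\<bar>m l\<bar> \<le> M1" if "\<bar>l\<bar> < 1" for l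
    unfolding m_def M1_def using that
    by (intro sum_abs[THEN order.trans] sum_mono)
      (auto simp: abs_mult power_abs intro!: mult_left_le power_le_one)
  obtain h H where h: "\<And>l. \<bar>l\<bar> < 1 \<Longrightarrow> \<bar>h l\<bar> \<le> H"
    and deth: "\<And>l. det (mat l + J) = l\<^sup>2 * (c + c1 * l + l\<^sup>2 * h l)"
    using det_mat_add_low_order[of J] det e1 unfolding c_def c1_def n_def J_def
    by (metis add.left_neutral mult_zero_left)
  obtain r R where r: "r > 0" and R: "\<And>l L. 0 < l \<Longrightarrow> l < r \<Longrightarrow> (mat l + J) ** L = mat 1 \<Longrightarrow>
      \<bar>l\<^sup>2 * trace (L ** A) - (l * \<beta> - \<alpha>)\<bar> \<le> l\<^sup>2 * R"
    using jordan_chain_trace_resolvent[OF chain, of A] unfolding \<alpha>_def \<beta>_def J_def by blast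
  \<comment> \<open>The last bound keeps the correction \<open>c1 * l + l\<^sup>2 * h l\<close>
    below \<open>\<bar>c\<bar>\<close>, so \<open>mat l + J\<close> is invertible; the summand 1
    keeps the denominator positive.\<close>
  define s where "s = min (min r 1) (\<bar>c\<bar> / (\<bar>c1\<bar> + \<bar>H\<bar> + 1))"
  have "s > 0" using r e2 by (auto simp: s_def c_def n_def J_def)
  define G where "G = \<bar>c\<bar> + \<bar>c1\<bar> + H"
  \<comment> \<open>The two coefficients of this affine function of \<open>l\<close> are the
    differences between actual and claimed derivatives.\<close>
  have bound: "\<bar>(E (int n) v + c * \<alpha>) + (E (int n - 1) v - (c * \<beta> - c1 * \<alpha>)) * l\<bar>
      \<le> l\<^sup>2 * (G * R + (\<bar>c1 * \<beta>\<bar> + H * (\<bar>\<beta>\<bar> + \<bar>\<alpha>\<bar>) + M1))"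
    if l: "0 < l" "l < s" for l
  proof -
    have l1: "l < 1" "l < r" "l < \<bar>c\<bar> / (\<bar>c1\<bar> + \<bar>H\<bar> + 1)" using l by (auto simp: s_def)
    define g where "g = c + c1 * l + l\<^sup>2 * h l"
    have "\<bar>c1 * l + l\<^sup>2 * h l\<bar> \<le> \<bar>c1\<bar> * l + l * \<bar>H\<bar>"
    proof -
      have "\<bar>l\<^sup>2 * h l\<bar> \<le> l * \<bar>H\<bar>"
        using mult_mono[of l 1 "\<bar>h l\<bar>" "\<bar>H\<bar>"] h[of l] l l1
        by (simp add: abs_mult power2_eq_square)
      then show ?thesis using l abs_triangle_ineq[of "c1 * l" "l\<^sup>2 * h l"] by (simp add: abs_mult)
    qed
    also have "\<dots> < \<bar>c\<bar>" using l1(3) l by (simp add: field_simps add_pos_nonneg)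
    finally have "g \<noteq> 0" unfolding g_def by linarith
    have "\<bar>c1 * l\<bar> \<le> \<bar>c1\<bar>" using l l1 by (simp add: abs_mult mult_left_le)
    moreover have "\<bar>l\<^sup>2 * h l\<bar> \<le> 1 * H"
      unfolding abs_mult using h[of l] l l1 by (intro mult_mono) (auto simp: power_le_one)
    ultimately have "\<bar>g\<bar> \<le> G" unfolding g_def G_def by linarith
    have detg: "det (mat l + J) = l\<^sup>2 * g" using deth by (simp add: g_def)
    then have "det (mat l + J) \<noteq> 0" using \<open>g \<noteq> 0\<close> l by simp
    then obtain L where L: "(mat l + J) ** L = mat 1" "L ** (mat l + J) = mat 1"
      by (metis invertible_def invertible_det_nz)
    \<comment> \<open>Multiplication by \<open>L\<close> moves the base point to the identity, where
      \<open>has_derivative_det_trace\<close> applies; the factor \<open>det (mat l + J)\<close>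
      later undoes it.\<close>
    have "((\<lambda>x. L ** (mat l + M x)) has_derivative (\<lambda>v. L ** M' v)) (at p)"
    proof -
      have "linear (\<lambda>B :: real^'n^'n. L ** B)"
        by (rule linearI) (simp_all add: matrix_add_ldistrib matrix_scalar_ac scalar_matrix_assoc
          flip: scalar_mult_eq_scaleR)
      then have bl: "bounded_linear (\<lambda>B :: real^'n^'n. L ** B)"
        by (rule linear_conv_bounded_linear[THEN iffD1])
      have "((\<lambda>x. mat l + M x) has_derivative M') (at p)"
        by (auto intro!: derivative_eq_intros M')
      from bounded_linear.has_derivative[OF bl this] show ?thesis .
    qed
    then have "((\<lambda>x. det (L ** (mat l + M x))) has_derivative (\<lambda>v. trace (L ** M' v))) (at p)"
      by (rule has_derivative_det_trace) (simp add: L flip: J_def)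
    then have "((\<lambda>x. det (mat l + J) * det (L ** (mat l + M x))) has_derivative
        (\<lambda>v. det (mat l + J) * trace (L ** M' v))) (at p)"
      by (rule has_derivative_mult_right)
    moreover have "det (mat l + J) * det (L ** (mat l + M x)) = det (mat l + M x)" for x
      using arg_cong[OF L(1), of det] by (simp add: det_mul)
    ultimately have "((\<lambda>x. det (mat l + M x)) has_derivative
        (\<lambda>v. det (mat l + J) * trace (L ** M' v))) (at p)"
      by simp
    moreover have "((\<lambda>x. det (mat l + M x)) has_derivative
        (\<lambda>v. \<Sum>j\<le>Suc (Suc n). E (int n - int j) v * l ^ j)) (at p)"
    proof -
      have "CARD('n) \<le> Suc (Suc n)" by (simp add: n_def)
      from det_mat_add[OF this] show ?thesis
        unfolding n_def[symmetric] by (simp only:) (intro has_derivative_sum has_derivative_mult_left E)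
    qed
    ultimately have "(\<lambda>v. \<Sum>j\<le>Suc (Suc n). E (int n - int j) v * l ^ j) =
        (\<lambda>v. det (mat l + J) * trace (L ** M' v))"
      by (rule has_derivative_unique[rotated])
    then have det_trace: "(\<Sum>j\<le>Suc (Suc n). E (int n - int j) v * l ^ j) = det (mat l + J) * trace (L ** A)"
      unfolding A_def by meson
    have "E (int n) v + E (int n - 1) v * l + l\<^sup>2 * m l = (\<Sum>j\<le>Suc (Suc n). E (int n - int j) v * l ^ j)"
      unfolding m_def
      by (simp add: sum.atMost_Suc_shift sum_distrib_left power2_eq_square algebra_simps
        diff_diff_eq del: sum.atMost_Suc)
    also have "\<dots> = g * (l\<^sup>2 * trace (L ** A))"
      unfolding det_trace detg by simp
    finally have key: "E (int n) v + E (int n - 1) v * l + l\<^sup>2 * m l = g * (l\<^sup>2 * trace (L ** A))" .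
    define T where "T = l\<^sup>2 * trace (L ** A) - (l * \<beta> - \<alpha>)"
    have T: "\<bar>T\<bar> \<le> l\<^sup>2 * R" unfolding T_def using R l l1 L by blast
    have "(E (int n) v + c * \<alpha>) + (E (int n - 1) v - (c * \<beta> - c1 * \<alpha>)) * l =
        g * (T + (l * \<beta> - \<alpha>)) - l\<^sup>2 * m l + c * \<alpha> - (c * \<beta> - c1 * \<alpha>) * l"
      using key by (simp add: T_def algebra_simps)
    \<comment> \<open>All terms of order 1 and \<open>l\<close> cancel, except those inside
      \<open>T\<close>, which is itself of order \<open>l\<^sup>2\<close>.\<close>
    also have "\<dots> = g * T + l\<^sup>2 * (c1 * \<beta> + h l * (l * \<beta> - \<alpha>) - m l)"
      by (simp add: g_def algebra_simps power2_eq_square)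
    finally have eq: "(E (int n) v + c * \<alpha>) + (E (int n - 1) v - (c * \<beta> - c1 * \<alpha>)) * l =
      g * T + l\<^sup>2 * (c1 * \<beta> + h l * (l * \<beta> - \<alpha>) - m l)" .
    have "\<bar>g * T\<bar> \<le> G * (l\<^sup>2 * R)"
      unfolding abs_mult using \<open>\<bar>g\<bar> \<le> G\<close> T by (intro mult_mono) auto
    moreover have "\<bar>l\<^sup>2 * (c1 * \<beta> + h l * (l * \<beta> - \<alpha>) - m l)\<bar> \<le> l\<^sup>2 * (\<bar>c1 * \<beta>\<bar> + H * (\<bar>\<beta>\<bar> + \<bar>\<alpha>\<bar>) + M1)"
    proof -
      have "\<bar>l * \<beta>\<bar> \<le> \<bar>\<beta>\<bar>" using l l1 by (simp add: abs_mult mult_left_le_one_le)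
      then have "\<bar>l * \<beta> - \<alpha>\<bar> \<le> \<bar>\<beta>\<bar> + \<bar>\<alpha>\<bar>" by linarith
      then have "\<bar>h l * (l * \<beta> - \<alpha>)\<bar> \<le> H * (\<bar>\<beta>\<bar> + \<bar>\<alpha>\<bar>)"
        unfolding abs_mult using h[of l] l l1 by (intro mult_mono) auto
      moreover have "\<bar>m l\<bar> \<le> M1" using m l l1 by simp
      ultimately have "\<bar>c1 * \<beta> + h l * (l * \<beta> - \<alpha>) - m l\<bar> \<le> \<bar>c1 * \<beta>\<bar> + H * (\<bar>\<beta>\<bar> + \<bar>\<alpha>\<bar>) + M1"
        by linarith
      then show ?thesis by (simp add: abs_mult mult_left_mono)
    qed
    ultimately show ?thesis
      unfolding eq distrib_left by (simp add: algebra_simps)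
  qed
  from affine_eq_0_if_quadratically_small[OF \<open>s > 0\<close> bound]
  have "E (int n) v + c * \<alpha> = 0" "E (int n - 1) v - (c * \<beta> - c1 * \<alpha>) = 0"
    by auto
  then show "E (int CARD('n)) v = - e_coeff (int CARD('n) - 2) (M p) * (p1 \<bullet> (M' v *v q0))"
    and "E (int CARD('n) - 1) v =
      e_coeff (int CARD('n) - 2) (M p) * (p0 \<bullet> (M' v *v q0) + p1 \<bullet> (M' v *v q1))
        - e_coeff (int CARD('n) - 3) (M p) * (p1 \<bullet> (M' v *v q0))"
    by (simp_all add: n_def c_def c1_def \<alpha>_def \<beta>_def A_def J_def)
qed

section \<open>The functions \<delta> and \<tau> and the transversality criteria\<close>

lemma open_regular_domain:
  assumes "open U" "C2_on U X"
  shows "open (regular_domain X U)"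
proof -
  have "continuous_on U (\<lambda>x. e_coeff (int CARD('a) - 2) (DX X x))"
    by (intro C1_on_imp_continuous_on C1_on_e_coeff C1_on_jacobian assms)
  then have "open (U \<inter> (\<lambda>x. e_coeff (int CARD('a) - 2) (DX X x)) -` (- {0}))"
    by (rule continuous_open_preimage) (use assms(1) in auto)
  also have "U \<inter> (\<lambda>x. e_coeff (int CARD('a) - 2) (DX X x)) -` (- {0}) = regular_domain X U"
    by (auto simp: regular_domain_def)
  finally show ?thesis .
qed

lemma C1_on_bt_delta_bt_tau:
  assumes "open U" "C2_on U X"
  shows "C1_on (regular_domain X U) (bt_delta X)" "C1_on (regular_domain X U) (bt_tau X)"
proof -
  have e: "C1_on (regular_domain X U) (\<lambda>x. e_coeff k (DX X x))" for k
    by (rule C1_on_subset[OF C1_on_e_coeff[OF C1_on_jacobian[OF assms]]]) (auto simp: regular_domain_def)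
  have inv: "C1_on (regular_domain X U) (\<lambda>x. inverse (e_coeff (int CARD('a) - 2) (DX X x)))"
    by (rule C1_on_inverse[OF e]) (simp add: regular_domain_def)
  show \<delta>: "C1_on (regular_domain X U) (bt_delta X)"
    unfolding bt_delta_def divide_inverse by (intro C1_on_mult e inv)
  \<comment> \<open>Rewritten with sums, products and inverses only, the operations covered by the
    closure rules.\<close>
  have "bt_tau X = (\<lambda>x. (e_coeff (int CARD('a) - 1) (DX X x) + (- 1) * (bt_delta X x * e_coeff (int CARD('a) - 3) (DX X x)))
        * inverse (e_coeff (int CARD('a) - 2) (DX X x)))"
    by (simp add: fun_eq_iff bt_tau_def divide_inverse)
  then show "C1_on (regular_domain X U) (bt_tau X)"
    by (simp only:) (intro C1_on_mult C1_on_add C1_on_const e inv \<delta>)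
qed

theorem corollary6p3:
  fixes X :: "real^'n \<Rightarrow> real^'n" and U :: "(real^'n) set"
    and p q0 :: "real^'n" and a b :: real
  assumes "CARD('n) \<ge> 2"
    and "open U" and "C2_on U X" and "p \<in> U" and "X p = 0"
    and "rank (DX X p) = CARD('n) - 1"
    and "e_coeff (int CARD('n) - 1) (DX X p) = 0"
    and "e_coeff (int CARD('n) - 2) (DX X p) \<noteq> 0"
    and "span {q0} = {v. DX X p *v v = 0}"
    and "(a, b) = bt_coefficients X p q0"
  shows "let U' = regular_domain X U;
             S\<^sub>\<delta> = {x\<in>U'. bt_delta X x = 0};
             S\<^sub>\<tau> = {x\<in>U'. bt_tau X x = 0}
         in open U' \<and>
            S\<^sub>\<delta> = {x\<in>U'. det (DX X x) = 0} \<and>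
            (a \<noteq> 0 \<longleftrightarrow> line_transversal U' (bt_delta X) p q0) \<and>
            (b \<noteq> 0 \<longleftrightarrow> line_transversal U' (bt_tau X) p q0) \<and>
            (a \<noteq> 0 \<longrightarrow> C1_hypersurface_near S\<^sub>\<delta> p) \<and>
            (b \<noteq> 0 \<longrightarrow> C1_hypersurface_near S\<^sub>\<tau> p)"
proof -
  define U' where "U' = regular_domain X U"
  define c where "c = e_coeff (int CARD('n) - 2) (DX X p)"
  have "c \<noteq> 0" using assms(8) by (simp add: c_def)
  obtain q1 p0 p1 where chain: "jordan_chain (DX X p) q0 q1 p0 p1"
    using jordan_chain_exists assms(1,6-9) by blast
  have ab: "2 * a = p1 \<bullet> D2X X p q0 q0" "b = p0 \<bullet> D2X X p q0 q0 + p1 \<bullet> D2X X p q0 q1"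
    using assms(10) bt_coefficients_eq[OF chain] by auto
  have "q0 \<noteq> 0" using chain by (auto simp: jordan_chain_def)
  moreover have "DX X p *v q0 = 0" using chain by (simp add: jordan_chain_def)
  ultimately have det0: "det (DX X p) = 0"
    by (metis invertible_def invertible_det_nz matrix_left_invertible_ker)
  have "open U'" unfolding U'_def by (rule open_regular_domain[OF assms(2,3)])
  have "p \<in> U'" using assms(4,8) by (simp add: U'_def regular_domain_def)
  have C1: "C1_on U' (bt_delta X)" "C1_on U' (bt_tau X)"
    unfolding U'_def by (rule C1_on_bt_delta_bt_tau[OF assms(2,3)])+
  have \<delta>0: "bt_delta X p = 0" by (simp add: bt_delta_def e_coeff_card det0)
  have \<tau>0: "bt_tau X p = 0" by (simp add: bt_tau_def \<delta>0 assms(7))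
  define E where "E k = frechet_derivative (\<lambda>x. e_coeff k (DX X x)) (at p)" for k
  have jac: "C1_on U (DX X)" by (rule C1_on_jacobian[OF assms(2,3)])
  have E: "((\<lambda>x. e_coeff k (DX X x)) has_derivative E k) (at p)" for k
    unfolding E_def by (rule C1_on_imp_has_derivative[OF C1_on_e_coeff[OF jac] assms(4)])
  \<comment> \<open>In the direction \<open>q0\<close> the matrix derivative applied to
    \<open>q0\<close> and \<open>q1\<close> is \<open>D2X\<close>, so the derivatives become
    expressions in \<open>a\<close>, \<open>b\<close> and \<open>c\<close>.\<close>
  note E_chain = e_coeff_derivative_jordan_chain[where M="DX X", OF chain det0 assms(7,8)
      C1_on_imp_has_derivative[OF jac assms(4)] E, folded D2X_def, of q0, folded ab c_def]
  have en: "e_coeff (int CARD('n)) (DX X p) = 0" by (simp add: e_coeff_card det0)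
  \<comment> \<open>The numerator vanishes at \<open>p\<close>, so the derivative of the denominator
    drops out of the quotient rule; the same happens for \<tau>.\<close>
  have d\<delta>: "(bt_delta X has_derivative (\<lambda>v. E (int CARD('n)) v / c)) (at p)"
    unfolding bt_delta_def using \<open>c \<noteq> 0\<close>
    by (auto intro!: derivative_eq_intros E simp: c_def en)
  have d\<tau>: "(bt_tau X has_derivative (\<lambda>v. (E (int CARD('n) - 1) v
      - E (int CARD('n)) v / c * e_coeff (int CARD('n) - 3) (DX X p)) / c)) (at p)"
    unfolding bt_tau_def using \<open>c \<noteq> 0\<close>
    by (auto intro!: derivative_eq_intros E d\<delta> simp: c_def \<delta>0 assms(7))
  have f\<delta>: "frechet_derivative (bt_delta X) (at p) q0 = - 2 * a"
    unfolding frechet_derivative_at[OF d\<delta>, symmetric] E_chain using \<open>c \<noteq> 0\<close> by simp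
  \<comment> \<open>The correction by \<delta> in the definition of \<tau> cancels exactly the term
    with \<open>2 * a\<close> in the derivative of the coefficient of index
    \<open>n - 1\<close>.\<close>
  have f\<tau>: "frechet_derivative (bt_tau X) (at p) q0 = b"
    unfolding frechet_derivative_at[OF d\<tau>, symmetric] E_chain using \<open>c \<noteq> 0\<close> by (simp add: field_simps)
  \<comment> \<open>A nonzero value at \<open>q0\<close> already makes the derivative itself
    nonzero.\<close>
  have trans: "line_transversal U' f p q0 \<longleftrightarrow> frechet_derivative f (at p) q0 \<noteq> 0"
    if "C1_on U' f" "f p = 0" for f
    unfolding line_transversal_def using that \<open>open U'\<close> \<open>p \<in> U'\<close> by auto
  have "{x\<in>U'. bt_delta X x = 0} = {x\<in>U'. det (DX X x) = 0}"
    by (auto simp: U'_def regular_domain_def bt_delta_def e_coeff_card)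
  moreover have "a \<noteq> 0 \<longleftrightarrow> line_transversal U' (bt_delta X) p q0"
    "b \<noteq> 0 \<longleftrightarrow> line_transversal U' (bt_tau X) p q0"
    using trans C1 \<delta>0 \<tau>0 f\<delta> f\<tau> by auto
  moreover have "a \<noteq> 0 \<longrightarrow> C1_hypersurface_near {x\<in>U'. bt_delta X x = 0} p"
    using C1_hypersurface_near_zero_set[OF \<open>open U'\<close> \<open>p \<in> U'\<close> C1(1) \<delta>0, of q0] f\<delta> by simp
  moreover have "b \<noteq> 0 \<longrightarrow> C1_hypersurface_near {x\<in>U'. bt_tau X x = 0} p"
    using C1_hypersurface_near_zero_set[OF \<open>open U'\<close> \<open>p \<in> U'\<close> C1(2) \<tau>0, of q0] f\<tau> by simp
  ultimately show ?thesis
    unfolding Let_def U'_def[symmetric] using \<open>open U'\<close> by blast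
qed

end
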